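(* Let $n\to\infty$, let $m=m(n)$ satisfy $m/n^4\to\infty$, and let $0\le p=p(n)\le 1$ be arbitrary. Put $\hat p:=1-(1-p^2)^m$. Then $$d_{TV}\big(G(n,m;p),\,G(n,\hat p)\big)=o(1).$$
   Context: For a collection of sets $L_1,\dots,L_n$, the intersection graph on $V=\{1,\dots,n\}$ joins distinct $i,j$ iff $L_i\cap L_j\neq\emptyset$. The random intersection graph $G(n,m;p)$ is the intersection graph generated by i.i.d. random subsets $L_1,\dots,L_n$ of $M=\{1,\dots,m\}$, where each element of $M$ belongs to $L_i$ with probability $p$ independently (so $\Pr[L_i=A]=p^{|A|}(1-p)^{m-|A|}$). $G(n,q)$ denotes the Erdős–Rényi binomial random graph on $V$ in which each pair is an edge independently with probability $q$. The total variation distance between graph-valued random variables $X,Y$ is $d_{TV}(X,Y)=\frac12\sum_G|\Pr[X=G]-\Pr[Y=G]|$, the sum over all graphs $G$ on $V$. *)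

theory Defs
  imports "HOL-Probability.Probability" "HOL-Probability.Product_PMF"
begin

text \<open>A simple graph on the fixed vertex set \<open>{1..n}\<close> is represented by its edge set,
  a set of two-element subsets of \<open>{1..n}\<close>.\<close>

definition vertex_pairs :: "nat \<Rightarrow> nat set set" where
  "vertex_pairs n = {{i, j} | i j. i \<in> {1..n} \<and> j \<in> {1..n} \<and> i \<noteq> j}"

definition graphs_on :: "nat \<Rightarrow> nat set set set" where
  "graphs_on n = Pow (vertex_pairs n)"

definition intersection_graph :: "nat \<Rightarrow> (nat \<Rightarrow> 'a set) \<Rightarrow> nat set set" where
  "intersection_graph n L =
     {{i, j} | i j. i \<in> {1..n} \<and> j \<in> {1..n} \<and> i \<noteq> j \<and> L i \<inter> L j \<noteq> {}}"

text \<open>Meaningful for finite \<open>S\<close> and \<open>0 \<le> q \<le> 1\<close>: \<^const>\<open>Pi_pmf\<close> is the product law only over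
  finite index sets, and \<^const>\<open>bernoulli_pmf\<close> clamps its parameter to the unit interval.
  The second argument of \<^const>\<open>Pi_pmf\<close> is a dummy value taken outside the index set.\<close>

definition binomial_subset :: "'a set \<Rightarrow> real \<Rightarrow> 'a set pmf" where
  "binomial_subset S q =
     map_pmf (\<lambda>f. {x \<in> S. f x}) (Pi_pmf S False (\<lambda>_. bernoulli_pmf q))"

text \<open>The laws of \<open>G(n,m;p)\<close> and \<open>G(n,q)\<close>.\<close>

definition random_intersection_graph :: "nat \<Rightarrow> nat \<Rightarrow> real \<Rightarrow> nat set set pmf" where
  "random_intersection_graph n m p =
     map_pmf (intersection_graph n) (Pi_pmf {1..n} {} (\<lambda>_. binomial_subset {1..m} p))"

definition erdos_renyi_graph :: "nat \<Rightarrow> real \<Rightarrow> nat set set pmf" where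
  "erdos_renyi_graph n q = binomial_subset (vertex_pairs n) q"

definition tv_dist_graphs :: "nat \<Rightarrow> nat set set pmf \<Rightarrow> nat set set pmf \<Rightarrow> real" where
  "tv_dist_graphs n X Y = 1 / 2 * (\<Sum>G\<in>graphs_on n. \<bar>pmf X G - pmf Y G\<bar>)"

end

(*
  Let E be the set of pairs of vertices. G(n,m;p) is the union of m independent cliques on
  binomial(p) vertex sets V, and G(n, 1-(1-p^2)^m) is the union of m independent binomial(p^2)
  subsets U of E. Replace the cliques by the sets U one at a time (Lindeberg's method).

  For a single replacement let g U be the change of a test function's mean when U is added to the
  remaining graph X. Expanding over subsets of V, the pairs contribute p^2 * sum_e g{e}, which
  cancels against the binomial subset, the triples contribute p^3 times a triangle term, and the
  remainder vanishes for |V| <= 3. A given pair is missing from X with probability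
  (1-p^2)^(m-1), so the remainders cost O(n^4 p^4 (1-p^2)^(m-1)) = O(n^4/m^2) per step.

  The triangle term is estimated in two ways. Trivially, it is O(n^3 p^3 (1-p^2)^(m-1)), that is
  O(n^3/m^(3/2)). After k replacements X contains an independent binomial(q) subset of E with
  q = 1-(1-p^2)^k; the planted triangles, corrected by their edges, have a density with respect
  to it that is an orthogonal sum, and its L2 norm gives O((n/k)^(3/2)). Using the first
  bound for k < m/n and the second one otherwise, everything adds up to O(n^2/sqrt m).
*)
theory Submission imports Defs "HOL-Library.Ramsey"
begin

section \<open>Binomial random subsets\<close>

lemma set_binomial_subset:
  assumes "finite S"
  shows "set_pmf (binomial_subset S q) \<subseteq> Pow S"
  by (auto simp: binomial_subset_def)

lemma finite_set_binomial_subset [simp]: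
  "finite S \<Longrightarrow> finite (set_pmf (binomial_subset S q))"
  by (meson finite_Pow_iff finite_subset set_binomial_subset)

lemma integrable_binomial_subset [simp]:
  fixes f :: "'a set \<Rightarrow> real"
  shows "finite S \<Longrightarrow> integrable (measure_pmf (binomial_subset S q)) f"
  by (simp add: integrable_measure_pmf_finite)

lemma expectation_swap_finite:
  fixes f :: "'a \<Rightarrow> 'b \<Rightarrow> real"
  assumes "finite (set_pmf M)" "finite (set_pmf N)"
  shows "measure_pmf.expectation M (\<lambda>x. measure_pmf.expectation N (f x))
       = measure_pmf.expectation N (\<lambda>y. measure_pmf.expectation M (\<lambda>x. f x y))"
proof -
  have M: "measure_pmf.expectation M g = (\<Sum>x\<in>set_pmf M. g x * pmf M x)" for g :: "'a \<Rightarrow> real"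
    by (rule integral_measure_pmf_real) (use assms in auto)
  have N: "measure_pmf.expectation N g = (\<Sum>x\<in>set_pmf N. g x * pmf N x)" for g :: "'b \<Rightarrow> real"
    by (rule integral_measure_pmf_real) (use assms in auto)
  show ?thesis
    unfolding M N
    by (simp add: sum_distrib_right sum_distrib_left sum.swap[of _ "set_pmf M"] mult_ac)
qed

lemma expectation_cong_pmf:
  fixes f g :: "'a \<Rightarrow> real"
  assumes "\<And>x. x \<in> set_pmf M \<Longrightarrow> f x = g x"
  shows "measure_pmf.expectation M f = measure_pmf.expectation M g"
  by (rule integral_cong_AE) (use assms in \<open>auto simp: AE_measure_pmf_iff\<close>)

lemma expectation_mono_finite:
  fixes f g :: "'a \<Rightarrow> real"
  assumes "finite (set_pmf M)" "\<And>x. x \<in> set_pmf M \<Longrightarrow> f x \<le> g x"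
  shows "measure_pmf.expectation M f \<le> measure_pmf.expectation M g"
  by (rule integral_mono_AE)
    (use assms in \<open>auto simp: AE_measure_pmf_iff integrable_measure_pmf_finite\<close>)

lemma expectation_bind_finite:
  fixes h :: "'b \<Rightarrow> real"
  assumes "finite (set_pmf M)" "\<And>x. x \<in> set_pmf M \<Longrightarrow> finite (set_pmf (N x))"
  shows "measure_pmf.expectation (bind_pmf M N) h
       = measure_pmf.expectation M (\<lambda>x. measure_pmf.expectation (N x) h)"
  using pmf_expectation_bind[of "set_pmf M" N M h] assms
    integral_measure_pmf_real[of "set_pmf M" M "\<lambda>x. measure_pmf.expectation (N x) h"]
  by (simp add: mult.commute)

lemma binomial_subset_empty [simp]: "binomial_subset {} q = return_pmf {}"
  by (simp add: binomial_subset_def)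

lemma binomial_subset_insert:
  assumes "finite S" "x \<notin> S"
  shows "binomial_subset (insert x S) q =
    do {b \<leftarrow> bernoulli_pmf q; U \<leftarrow> binomial_subset S q; return_pmf (if b then insert x U else U)}"
proof -
  have *: "{y. (y = x \<or> y \<in> S) \<and> (f(x := b)) y} = (if b then insert x {y \<in> S. f y} else {y \<in> S. f y})"
    for f :: "'a \<Rightarrow> bool" and b
    using assms(2) by auto
  show ?thesis
    unfolding binomial_subset_def Pi_pmf_insert'[OF assms]
    by (simp add: map_bind_pmf bind_map_pmf * map_pmf_def bind_assoc_pmf bind_return_pmf
        del: fun_upd_apply)
qed

context
  fixes q :: real
  assumes q: "0 \<le> q" "q \<le> 1"
begin

lemma expectation_binomial_subset_insert:
  fixes h :: "'a set \<Rightarrow> real"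
  assumes "finite S" "x \<notin> S"
  shows "measure_pmf.expectation (binomial_subset (insert x S) q) h
     = q * measure_pmf.expectation (binomial_subset S q) (\<lambda>U. h (insert x U))
     + (1 - q) * measure_pmf.expectation (binomial_subset S q) h"
  using assms q by (simp add: binomial_subset_insert expectation_bind_finite mult.commute)

text \<open>The memberships \<open>x \<in> U\<close> are independent. Joint moments are computed
  below by padding a product with factors 1 until it runs over all of \<open>S\<close>.\<close>

lemma expectation_binomial_subset_prod:
  fixes f :: "'a \<Rightarrow> bool \<Rightarrow> real"
  assumes "finite S"
  shows "measure_pmf.expectation (binomial_subset S q) (\<lambda>U. \<Prod>x\<in>S. f x (x \<in> U))
       = (\<Prod>x\<in>S. q * f x True + (1 - q) * f x False)"
  using assms
proof (induction S)
  case (insert x S)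
  let ?P = "\<lambda>U. \<Prod>y\<in>S. f y (y \<in> U)"
  have P: "(\<Prod>y\<in>S. f y (y = x \<or> y \<in> U)) = ?P U" for U
  proof (intro prod.cong refl)
    fix y assume "y \<in> S"
    then show "f y (y = x \<or> y \<in> U) = f y (y \<in> U)"
      using insert.hyps by (cases "y = x") auto
  qed
  have "measure_pmf.expectation (binomial_subset S q) (\<lambda>U. f x (x \<in> U) * ?P U)
      = f x False * measure_pmf.expectation (binomial_subset S q) ?P"
    unfolding integral_mult_right_zero[symmetric]
  proof (intro expectation_cong_pmf)
    fix U assume "U \<in> set_pmf (binomial_subset S q)"
    then have "x \<notin> U"
      using insert.hyps set_binomial_subset[of S q] by auto
    then show "f x (x \<in> U) * ?P U = f x False * ?P U" by simp
  qed
  then show ?case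
    using insert by (simp add: expectation_binomial_subset_insert P algebra_simps)
qed simp

lemma expectation_binomial_subset_superset:
  assumes "finite S" "T \<subseteq> S"
  shows "measure_pmf.expectation (binomial_subset S q) (\<lambda>U. of_bool (T \<subseteq> U)) = q ^ card T"
proof -
  have *: "of_bool (T \<subseteq> U) = (\<Prod>x\<in>S. if x \<in> T then of_bool (x \<in> U) else 1 :: real)" for U
  proof (cases "T \<subseteq> U")
    case False
    with assms have "(\<Prod>x\<in>S. if x \<in> T then of_bool (x \<in> U) else 1 :: real) = 0"
      by (intro prod_zero) auto
    with False show ?thesis by simp
  qed (auto intro!: prod.neutral)
  have "(\<Prod>x\<in>S. q * (if x \<in> T then of_bool True else 1) + (1 - q) * (if x \<in> T then of_bool False else 1))
      = (\<Prod>x\<in>S. if x \<in> T then q else 1)"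
    by (intro prod.cong) auto
  also have "\<dots> = q ^ card T"
    using assms by (simp add: prod.If_cases Int_absorb1)
  finally show ?thesis
    unfolding * expectation_binomial_subset_prod[OF assms(1),
        of "\<lambda>x b. if x \<in> T then of_bool b else 1"] .
qed

text \<open>By linearity, since a fixed \<open>k\<close>-set survives in \<open>V\<close> with
  probability \<open>q ^ k\<close>. This turns expansions over small vertex sets into powers of the
  edge or vertex probability.\<close>

lemma expectation_binomial_subset_nsets:
  fixes c :: "'a set \<Rightarrow> real"
  assumes "finite S"
  shows "measure_pmf.expectation (binomial_subset S q) (\<lambda>V. \<Sum>t\<in>nsets V k. c t)
       = q ^ k * (\<Sum>t\<in>nsets S k. c t)"
proof -
  have "measure_pmf.expectation (binomial_subset S q) (\<lambda>V. \<Sum>t\<in>nsets V k. c t)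
      = measure_pmf.expectation (binomial_subset S q) (\<lambda>V. \<Sum>t\<in>nsets S k. c t * of_bool (t \<subseteq> V))"
  proof (intro expectation_cong_pmf)
    fix V assume "V \<in> set_pmf (binomial_subset S q)"
    then have "V \<subseteq> S" using set_binomial_subset[OF assms] by auto
    then have "nsets V k = {t \<in> nsets S k. t \<subseteq> V}" by (auto simp: nsets_def)
    then show "(\<Sum>t\<in>nsets V k. c t) = (\<Sum>t\<in>nsets S k. c t * of_bool (t \<subseteq> V))"
      using assms by (simp add: of_bool_def if_distrib sum.If_cases finite_imp_finite_nsets Int_def cong: if_cong)
  qed
  also have "\<dots> = (\<Sum>t\<in>nsets S k. c t * q ^ k)"
    using assms
    by (subst Bochner_Integration.integral_sum)
       (auto simp: expectation_binomial_subset_superset nsets_def intro!: sum.cong)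
  finally show ?thesis by (simp add: sum_distrib_left mult.commute)
qed

text \<open>Change of measure: \<open>Y \<union> T\<close> is distributed as \<open>Y\<close>
  conditioned on \<open>T \<subseteq> Y\<close>, so planting \<open>T\<close> amounts to a density
  with respect to the unplanted law. That density is what the second moment argument works
  with.\<close>

lemma expectation_binomial_subset_planted:
  fixes h :: "'a set \<Rightarrow> real"
  assumes "finite S" "T \<subseteq> S" "0 < q"
  shows "measure_pmf.expectation (binomial_subset S q) (\<lambda>Y. h (Y \<union> T))
       = measure_pmf.expectation (binomial_subset S q) (\<lambda>Y. h Y * (of_bool (T \<subseteq> Y) / q ^ card T))"
proof -
  have "finite T" using assms finite_subset by blast
  then show ?thesis using assms(2)
  proof (induction T arbitrary: h)
    case (insert e T)
    define S' where "S' = S - {e}"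
    have S: "S = insert e S'" "e \<notin> S'" "finite S'"
      using insert.prems assms(1) by (auto simp: S'_def)
    \<comment> \<open>A single planted element: split on whether \<open>e\<close> was present
      already.\<close>
    have one: "measure_pmf.expectation (binomial_subset S q) (\<lambda>Y. g (insert e Y))
       = measure_pmf.expectation (binomial_subset S q) (\<lambda>Y. g Y * of_bool (e \<in> Y)) / q" for g :: "'a set \<Rightarrow> real"
    proof -
      have "measure_pmf.expectation (binomial_subset S' q) (\<lambda>Y. g Y * of_bool (e \<in> Y))
         = measure_pmf.expectation (binomial_subset S' q) (\<lambda>Y. 0)"
        using set_binomial_subset[OF S(3)] S(2) by (intro expectation_cong_pmf) auto
      then show ?thesis
        using S assms(3) by (simp add: expectation_binomial_subset_insert field_simps)
    qed
    have "measure_pmf.expectation (binomial_subset S q) (\<lambda>Y. h (Y \<union> insert e T))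
        = measure_pmf.expectation (binomial_subset S q) (\<lambda>Y. h (Y \<union> T) * of_bool (e \<in> Y)) / q"
      using one[of "\<lambda>Y. h (Y \<union> T)"] by simp
    \<comment> \<open>As \<open>e \<notin> T\<close>, membership of \<open>e\<close> is not affected
      by adding \<open>T\<close>. The indicator can thus be absorbed into the test function, to
      which the induction hypothesis applies.\<close>
    also have "\<dots> = measure_pmf.expectation (binomial_subset S q)
        (\<lambda>Y. (\<lambda>Z. h Z * of_bool (e \<in> Z)) (Y \<union> T)) / q"
      using insert.hyps by simp
    also have "\<dots> = measure_pmf.expectation (binomial_subset S q)
        (\<lambda>Y. h Y * of_bool (e \<in> Y) * (of_bool (T \<subseteq> Y) / q ^ card T)) / q"
      using insert.prems by (subst insert.IH) auto
    also have "\<dots> = measure_pmf.expectation (binomial_subset S q)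
        (\<lambda>Y. h Y * (of_bool (insert e T \<subseteq> Y) / q ^ card (insert e T)))"
      unfolding integral_divide_zero[symmetric] using insert.hyps
      by (intro expectation_cong_pmf) (auto simp: field_simps)
    finally show ?case .
  qed simp
qed

end

text \<open>An element is missed by both independent sets with probability
  \<open>(1 - q) * (1 - r)\<close>. This merges successive layers of independent edges into one
  binomial set.\<close>

lemma expectation_binomial_subset_union:
  fixes h :: "'a set \<Rightarrow> real"
  assumes "finite S" and q: "0 \<le> q" "q \<le> 1" and r: "0 \<le> r" "r \<le> 1"
  shows "measure_pmf.expectation (binomial_subset S (1 - (1 - q) * (1 - r))) h
       = measure_pmf.expectation (binomial_subset S q)
           (\<lambda>Y. measure_pmf.expectation (binomial_subset S r) (\<lambda>U. h (Y \<union> U)))"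
  using assms(1)
proof (induction S arbitrary: h)
  case (insert x S)
  have qr: "0 \<le> 1 - (1 - q) * (1 - r)" "1 - (1 - q) * (1 - r) \<le> 1"
    using q r by (auto intro: mult_le_one)
  show ?case
    unfolding expectation_binomial_subset_insert[OF qr insert.hyps] insert.IH
    using insert.hyps
    by (simp add: expectation_binomial_subset_insert q r) (simp add: algebra_simps)
qed simp

section \<open>Planted triangles in a binomial random subset\<close>

text \<open>The unnormalised Walsh characters of the \<open>q\<close>-biased product measure: for
  \<open>0 < q\<close> each factor has mean 0 and variance \<open>(1 - q) / q\<close>.\<close>

definition centred_prod :: "real \<Rightarrow> 'a set \<Rightarrow> 'a set \<Rightarrow> real" where
  "centred_prod q S Y = (\<Prod>e\<in>S. of_bool (e \<in> Y) / q - 1)"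

lemma centred_prod_singleton [simp]: "centred_prod q {e} Y = of_bool (e \<in> Y) / q - 1"
  by (simp add: centred_prod_def)

text \<open>Orthogonality: an element in exactly one of \<open>A\<close>, \<open>B\<close>
  contributes a factor of mean 0, an element in both contributes the variance
  \<open>(1 - q) / q\<close>.\<close>

lemma expectation_centred_prod_mult:
  assumes "finite E" "A \<subseteq> E" "B \<subseteq> E" "0 < q" "q \<le> 1"
  shows "measure_pmf.expectation (binomial_subset E q) (\<lambda>Y. centred_prod q A Y * centred_prod q B Y)
       = (if A = B then ((1 - q) / q) ^ card A else 0)"
proof -
  define f where "f e b = (if e \<in> A then of_bool b / q - 1 else 1) * (if e \<in> B then of_bool b / q - 1 else 1)"
    for e :: 'a and b
  have extend: "centred_prod q S Y = (\<Prod>e\<in>E. if e \<in> S then of_bool (e \<in> Y) / q - 1 else 1)"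
    if "S \<subseteq> E" for S Y
    unfolding centred_prod_def using assms(1) that by (simp add: prod.If_cases Int_absorb1)
  have f_mean: "q * f e True + (1 - q) * f e False
      = (if e \<in> A \<inter> B then (1 - q) / q else if e \<in> A \<union> B then 0 else 1)" for e
    using assms(4) by (auto simp: f_def field_simps power2_eq_square)
  have "measure_pmf.expectation (binomial_subset E q) (\<lambda>Y. centred_prod q A Y * centred_prod q B Y)
      = measure_pmf.expectation (binomial_subset E q) (\<lambda>Y. \<Prod>e\<in>E. f e (e \<in> Y))"
    using assms(2,3) by (simp add: extend f_def prod.distrib)
  also have "\<dots> = (\<Prod>e\<in>E. if e \<in> A \<inter> B then (1 - q) / q else if e \<in> A \<union> B then 0 else 1)"
    using assms by (simp only: expectation_binomial_subset_prod f_mean order_less_imp_le)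
  also have "\<dots> = (if A = B then ((1 - q) / q) ^ card A else 0)"
  proof (cases "A = B")
    case True
    then have "(\<Prod>e\<in>E. if e \<in> A \<inter> B then (1 - q) / q else if e \<in> A \<union> B then 0 else 1)
             = (\<Prod>e\<in>E. if e \<in> A then (1 - q) / q else 1)"
      by (intro prod.cong) auto
    with True show ?thesis
      using assms by (simp add: prod.If_cases Int_absorb1)
  next
    case False
    then obtain e where "e \<in> (A \<union> B) - (A \<inter> B)" by blast
    with False assms show ?thesis
      by (auto intro!: prod_zero bexI[of _ e])
  qed
  finally show ?thesis .
qed

text \<open>Multiply out the product over \<open>P\<close> of
  \<open>1 + (of_bool (e \<in> Y) / q - 1)\<close>. This is the orthogonal expansion of the density
  of planting \<open>P\<close>.\<close>

lemma sum_centred_prod_Pow: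
  assumes "finite P"
  shows "(\<Sum>S\<in>Pow P. centred_prod q S Y) = of_bool (P \<subseteq> Y) / q ^ card P"
  using assms
proof (induction P)
  case (insert e P)
  have "(\<Sum>S\<in>Pow (insert e P). centred_prod q S Y)
      = (\<Sum>S\<in>Pow P. centred_prod q S Y) + (\<Sum>S\<in>insert e ` Pow P. centred_prod q S Y)"
    unfolding Pow_insert using insert.hyps by (intro sum.union_disjoint) auto
  also have "(\<Sum>S\<in>insert e ` Pow P. centred_prod q S Y)
      = (\<Sum>S\<in>Pow P. (of_bool (e \<in> Y) / q - 1) * centred_prod q S Y)"
  proof (subst sum.reindex)
    show "inj_on (insert e) (Pow P)"
      using insert.hyps by (auto simp: inj_on_def)
    show "sum ((\<lambda>S. centred_prod q S Y) \<circ> insert e) (Pow P)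
        = (\<Sum>S\<in>Pow P. (of_bool (e \<in> Y) / q - 1) * centred_prod q S Y)"
    proof (intro sum.cong refl)
      fix S assume "S \<in> Pow P"
      then have "finite S" "e \<notin> S" using insert.hyps finite_subset by auto
      then show "((\<lambda>S. centred_prod q S Y) \<circ> insert e) S
          = (of_bool (e \<in> Y) / q - 1) * centred_prod q S Y"
        by (simp add: centred_prod_def)
    qed
  qed
  also have "\<dots> = (of_bool (e \<in> Y) / q - 1) * (\<Sum>S\<in>Pow P. centred_prod q S Y)"
    by (simp add: sum_distrib_left)
  finally show ?case
    using insert by (auto simp: left_diff_distrib diff_divide_distrib)
qed (simp add: centred_prod_def)

text \<open>Subtracting the constant and the single-edge parts from the expansion of a planted
  density leaves the characters of order at least two.\<close>

lemma sum_Pow_card_ge_2: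
  fixes f :: "'a set \<Rightarrow> real"
  assumes "finite P"
  shows "(\<Sum>S | S \<subseteq> P \<and> 2 \<le> card S. f S) = (\<Sum>S\<in>Pow P. f S) - f {} - (\<Sum>e\<in>P. f {e})"
proof -
  have "Pow P = {{}} \<union> ((\<lambda>e. {e}) ` P \<union> {S. S \<subseteq> P \<and> 2 \<le> card S})"
  proof (intro equalityI subsetI)
    fix S assume "S \<in> Pow P"
    then have S: "S \<subseteq> P" "finite S" using assms finite_subset by auto
    consider "card S = 0" | "card S = 1" | "2 \<le> card S" by linarith
    then show "S \<in> {{}} \<union> ((\<lambda>e. {e}) ` P \<union> {S. S \<subseteq> P \<and> 2 \<le> card S})"
      by cases (use S in \<open>auto simp: card_1_singleton_iff\<close>)
  qed auto
  then have "(\<Sum>S\<in>Pow P. f S) = (\<Sum>S\<in>{{}} \<union> ((\<lambda>e. {e}) ` P \<union> {S. S \<subseteq> P \<and> 2 \<le> card S}). f S)"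
    by simp
  also have "\<dots> = f {} + ((\<Sum>S\<in>(\<lambda>e. {e}) ` P. f S) + (\<Sum>S | S \<subseteq> P \<and> 2 \<le> card S. f S))"
    using assms by (subst sum.union_disjoint; (subst sum.union_disjoint)?; auto)
  finally show ?thesis
    by (simp add: sum.reindex)
qed

text \<open>Three edges form three pairs and one triple. With \<open>r = (1 - q) / q\<close> this is
  the second moment of one triangle's corrected density.\<close>

lemma sum_power_card_ge_2:
  assumes "finite P" "card P = 3"
  shows "(\<Sum>S | S \<subseteq> P \<and> 2 \<le> card S. r ^ card S) = 3 * r\<^sup>2 + (r :: real) ^ 3"
proof -
  obtain a b c where P: "P = {a, b, c}" "a \<noteq> b" "b \<noteq> c" "a \<noteq> c"
    using assms(2) by (auto simp: card_3_iff)
  have "(\<Sum>S | S \<subseteq> P \<and> 2 \<le> card S. r ^ card S) = (\<Sum>S\<in>Pow P. r ^ card S) - 1 - 3 * r"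
    using assms by (simp add: sum_Pow_card_ge_2)
  also have "(\<Sum>S\<in>Pow P. r ^ card S) = (\<Sum>S\<in>{{}, {a}, {b}, {c}, {a, b}, {b, c}, {a, c}, {a, b, c}}. r ^ card S)"
    by (rule arg_cong[where f = "sum _"]) (auto simp: P(1) Pow_insert)
  also have "\<dots> = 1 + 3 * r + 3 * r\<^sup>2 + r ^ 3"
  proof -
    have "{a, b} \<noteq> {b, c}" "{a, b} \<noteq> {a, c}" "{b, c} \<noteq> {a, c}"
      "{a, b} \<noteq> {a, b, c}" "{b, c} \<noteq> {a, b, c}" "{a, c} \<noteq> {a, b, c}"
      using P(2-) by auto
    then show ?thesis
      using P(2-) by (simp add: eval_nat_numeral)
  qed
  finally show ?thesis by simp
qed

text \<open>Cauchy-Schwarz for a bounded test function, obtained from the nonnegativity of a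
  variance.\<close>

lemma expectation_le_sqrt_second_moment:
  fixes h W :: "'a \<Rightarrow> real"
  assumes "finite (set_pmf M)" "\<And>x. \<bar>h x\<bar> \<le> 1"
  shows "\<bar>measure_pmf.expectation M (\<lambda>x. h x * W x)\<bar> \<le> sqrt (measure_pmf.expectation M (\<lambda>x. (W x)\<^sup>2))"
proof -
  let ?X = "\<lambda>x. h x * W x"
  have int: "integrable (measure_pmf M) f" for f :: "'a \<Rightarrow> real"
    using assms(1) by (rule integrable_measure_pmf_finite)
  have "0 \<le> measure_pmf.variance M ?X"
    by (rule measure_pmf.variance_positive)
  then have "(measure_pmf.expectation M ?X)\<^sup>2 \<le> measure_pmf.expectation M (\<lambda>x. (?X x)\<^sup>2)"
    using measure_pmf.variance_eq[where X = ?X, OF int int] by simp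
  also have "\<dots> \<le> measure_pmf.expectation M (\<lambda>x. (W x)\<^sup>2)"
  proof (rule expectation_mono_finite[OF assms(1)])
    fix x
    have "(h x)\<^sup>2 \<le> 1" using assms(2) by (simp add: abs_square_le_1)
    then show "(?X x)\<^sup>2 \<le> (W x)\<^sup>2"
      by (simp add: power_mult_distrib mult_left_le_one_le)
  qed
  finally show ?thesis
    by (simp add: real_le_rsqrt)
qed

text \<open>After the change of measure, the sum is the mean of \<open>h\<close> times a sum of
  centred products over sets of at least two edges of a triangle. Such a set determines its
  triangle, so different triangles share no character. The second moment therefore has no cross
  terms and grows only linearly in the number of triangles.\<close>

lemma expectation_planted_triangles:
  fixes h :: "'a set set \<Rightarrow> real"
  assumes "finite W" "0 < q" "q \<le> 1" and h: "\<And>Y. \<bar>h Y\<bar> \<le> 1"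
  defines "\<Phi> \<equiv> \<lambda>U. measure_pmf.expectation (binomial_subset (nsets W 2) q) (\<lambda>Y. h (Y \<union> U))
             - measure_pmf.expectation (binomial_subset (nsets W 2) q) h"
  shows "\<bar>\<Sum>t\<in>nsets W 3. \<Phi> (nsets t 2) - (\<Sum>e\<in>nsets t 2. \<Phi> {e})\<bar>
       \<le> sqrt (real (card W choose 3) * (3 * ((1 - q) / q)\<^sup>2 + ((1 - q) / q) ^ 3))"
proof -
  let ?E = "nsets W 2" and ?r = "(1 - q) / q"
  let ?B = "binomial_subset (nsets W 2) q"
  define F where "F t = {S. S \<subseteq> nsets t 2 \<and> 2 \<le> card S}" for t :: "'a set"
  define D where "D = Sigma (nsets W 3) F"
  have fin: "finite ?E" "finite (nsets W 3)"
    using assms(1) by (auto intro: finite_imp_finite_nsets)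
  have t: "finite (nsets t 2)" "nsets t 2 \<subseteq> ?E" "card (nsets t 2) = 3" if "t \<in> nsets W 3" for t
    using that nsets_mono[of t W 2] by (auto simp: nsets_def[of W 3] finite_imp_finite_nsets choose_two)
  have finF: "finite (F t)" if "t \<in> nsets W 3" for t
    using t[OF that] by (auto simp: F_def)
  \<comment> \<open>Two distinct edges of a triangle cover its three vertices, so the triangle is
    the union of any edge set in \<open>F t\<close>.\<close>
  have recover: "\<Union> S = t" if "t \<in> nsets W 3" "S \<in> F t" for t S
  proof -
    have tt: "finite t" "card t = 3" using that by (auto simp: nsets_def)
    have S: "S \<subseteq> nsets t 2" "2 \<le> card S" using that by (auto simp: F_def)
    have "finite S"
      using S(1) t(1)[OF that(1)] finite_subset by blast
    with S(2) obtain e f where ef: "e \<in> S" "f \<in> S" "e \<noteq> f"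
      using card_le_Suc0_iff_eq[of S] by force
    have ef2: "e \<subseteq> t" "f \<subseteq> t" "card e = 2" "card f = 2" "finite e" "finite f"
      using ef S by (auto simp: nsets_def)
    then have "e \<subset> e \<union> f"
      using ef(3) by (metis Un_upper1 Un_upper2 card_subset_eq psubsetI)
    then have "card e < card (e \<union> f)"
      using ef2 by (intro psubset_card_mono) auto
    then have "e \<union> f = t"
      using ef2 tt by (intro card_seteq) auto
    then show ?thesis using ef S by (auto simp: nsets_def)
  qed
  \<comment> \<open>Hence distinct pairs in \<open>D\<close> carry distinct edge sets, and their
    centred products are orthogonal.\<close>
  have inj: "snd x = snd y \<Longrightarrow> x = y" if "x \<in> D" "y \<in> D" for x y
    using that recover unfolding D_def by (metis SigmaE snd_conv)
  have \<Phi>: "\<Phi> U = measure_pmf.expectation ?B (\<lambda>Y. h Y * (of_bool (U \<subseteq> Y) / q ^ card U - 1))"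
    if "U \<subseteq> ?E" for U
    using assms fin that
    by (simp add: \<Phi>_def expectation_binomial_subset_planted right_diff_distrib)
  have term_eq: "\<Phi> (nsets t 2) - (\<Sum>e\<in>nsets t 2. \<Phi> {e})
      = measure_pmf.expectation ?B (\<lambda>Y. h Y * (\<Sum>S\<in>F t. centred_prod q S Y))" if "t \<in> nsets W 3" for t
  proof -
    have *: "(\<Sum>S\<in>F t. centred_prod q S Y) = of_bool (nsets t 2 \<subseteq> Y) / q ^ card (nsets t 2) - 1
        - (\<Sum>e\<in>nsets t 2. of_bool ({e} \<subseteq> Y) / q ^ card {e} - 1)" for Y
      unfolding F_def using t[OF that]
      by (simp add: sum_Pow_card_ge_2 sum_centred_prod_Pow) (simp add: centred_prod_def)
    have "(\<Sum>e\<in>nsets t 2. \<Phi> {e}) = (\<Sum>e\<in>nsets t 2. measure_pmf.expectation ?B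
        (\<lambda>Y. h Y * (of_bool ({e} \<subseteq> Y) / q ^ card {e} - 1)))"
      using t[OF that] by (intro sum.cong \<Phi>) auto
    then show ?thesis
      unfolding * \<Phi>[OF t(2)[OF that]]
      using fin by (simp add: right_diff_distrib sum_distrib_left)
  qed
  have sum_D: "(\<Sum>x\<in>D. g (snd x)) = (\<Sum>t\<in>nsets W 3. \<Sum>S\<in>F t. g S)" for g :: "'a set set \<Rightarrow> real"
    unfolding D_def using fin finF by (subst sum.Sigma) (auto simp: split_beta)
  have "(\<Sum>t\<in>nsets W 3. \<Phi> (nsets t 2) - (\<Sum>e\<in>nsets t 2. \<Phi> {e}))
      = measure_pmf.expectation ?B (\<lambda>Y. h Y * (\<Sum>x\<in>D. centred_prod q (snd x) Y))"
    using fin by (simp add: term_eq sum_distrib_left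
        sum_D[of "\<lambda>S. measure_pmf.expectation ?B (\<lambda>Y. h Y * centred_prod q S Y)"])
  also have "\<bar>\<dots>\<bar> \<le> sqrt (measure_pmf.expectation ?B (\<lambda>Y. (\<Sum>x\<in>D. centred_prod q (snd x) Y)\<^sup>2))"
    using fin h by (intro expectation_le_sqrt_second_moment) auto
  also have "measure_pmf.expectation ?B (\<lambda>Y. (\<Sum>x\<in>D. centred_prod q (snd x) Y)\<^sup>2)
      = (\<Sum>x\<in>D. \<Sum>y\<in>D. measure_pmf.expectation ?B (\<lambda>Y. centred_prod q (snd x) Y * centred_prod q (snd y) Y))"
    using fin by (simp add: power2_eq_square sum_product)
  also have "\<dots> = (\<Sum>x\<in>D. \<Sum>y\<in>D. if x = y then ?r ^ card (snd x) else 0)"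
  proof (intro sum.cong refl)
    fix x y assume xy: "x \<in> D" "y \<in> D"
    then have "snd x \<subseteq> ?E" "snd y \<subseteq> ?E"
      using t(2) by (auto simp: D_def F_def) blast+
    then show "measure_pmf.expectation ?B (\<lambda>Y. centred_prod q (snd x) Y * centred_prod q (snd y) Y)
        = (if x = y then ?r ^ card (snd x) else 0)"
      using fin assms inj[OF xy] by (auto simp: expectation_centred_prod_mult)
  qed
  also have "\<dots> = (\<Sum>x\<in>D. ?r ^ card (snd x))"
    using fin finF by (intro sum.cong) (auto simp: D_def)
  also have "\<dots> = (\<Sum>t\<in>nsets W 3. \<Sum>S\<in>F t. ?r ^ card S)"
    by (rule sum_D)
  also have "\<dots> = (\<Sum>t\<in>nsets W 3. 3 * ?r\<^sup>2 + ?r ^ 3)"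
    unfolding F_def using t by (intro sum.cong refl sum_power_card_ge_2) auto
  also have "\<dots> = real (card W choose 3) * (3 * ?r\<^sup>2 + ?r ^ 3)"
    using assms by (simp add: card_nsets)
  finally show ?thesis .
qed

section \<open>Adding one element to the ground set\<close>

lemma vertex_pairs_eq_nsets: "vertex_pairs n = nsets {1..n} 2"
  unfolding vertex_pairs_def nsets_2_eq by blast

lemma finite_vertex_pairs [simp]: "finite (vertex_pairs n)"
  by (simp add: vertex_pairs_eq_nsets finite_imp_finite_nsets)

lemma intersection_graph_subset: "intersection_graph n L \<subseteq> vertex_pairs n"
  by (auto simp: intersection_graph_def vertex_pairs_def)

lemma set_random_intersection_graph:
  "set_pmf (random_intersection_graph n m p) \<subseteq> Pow (vertex_pairs n)"
  using intersection_graph_subset by (auto simp: random_intersection_graph_def)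

lemma finite_set_random_intersection_graph [simp]:
  "finite (set_pmf (random_intersection_graph n m p))"
  using set_random_intersection_graph by (rule finite_subset) simp

lemma random_intersection_graph_0: "random_intersection_graph n 0 p = return_pmf {}"
  by (simp add: random_intersection_graph_def intersection_graph_def)

text \<open>The fresh element \<open>a\<close> is shared exactly by the vertices satisfying
  \<open>B\<close>, so it contributes the clique on them. The value \<open>{}\<close> outside
  \<open>{1..n}\<close> matches the dummy value of the product law.\<close>

lemma intersection_graph_add_element:
  assumes "\<And>i. i \<in> {1..n} \<Longrightarrow> a \<notin> L i"
  shows "intersection_graph n (\<lambda>i. if i \<in> {1..n} then if B i then insert a (L i) else L i else {})
       = intersection_graph n L \<union> nsets {i \<in> {1..n}. B i} 2" (is "?lhs = ?rhs")
proof (intro equalityI subsetI)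
  define L' where "L' i = (if i \<in> {1..n} then if B i then insert a (L i) else L i else {})" for i
  fix e assume "e \<in> ?lhs"
  then have "e \<in> intersection_graph n L'" by (simp add: L'_def[abs_def])
  then obtain i j where ij: "e = {i, j}" "i \<in> {1..n}" "j \<in> {1..n}" "i \<noteq> j" "L' i \<inter> L' j \<noteq> {}"
    unfolding intersection_graph_def by blast
  show "e \<in> ?rhs"
  proof (cases "L i \<inter> L j = {}")
    case True
    then have "B i \<and> B j" using ij assms by (auto simp: L'_def split: if_splits)
    with ij show ?thesis by auto
  qed (use ij in \<open>auto simp: intersection_graph_def\<close>)
next
  fix e assume "e \<in> ?rhs"
  then show "e \<in> ?lhs"
  proof
    assume "e \<in> nsets {i \<in> {1..n}. B i} 2"
    then show ?thesis
      by (auto elim!: nsets2_E simp: intersection_graph_def)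
  next
    assume "e \<in> intersection_graph n L"
    then obtain i j where "e = {i, j}" "i \<in> {1..n}" "j \<in> {1..n}" "i \<noteq> j" "L i \<inter> L j \<noteq> {}"
      by (auto simp: intersection_graph_def)
    then show ?thesis
      unfolding intersection_graph_def by (intro CollectI exI[of _ i] exI[of _ j]) auto
  qed
qed

text \<open>The vertices that choose the new element form a binomial set independent of all earlier
  choices. Iterating this exhibits the graph as a union of \<open>m\<close> independent random
  cliques.\<close>

lemma random_intersection_graph_Suc:
  "random_intersection_graph n (Suc m) p =
     do {G \<leftarrow> random_intersection_graph n m p; V \<leftarrow> binomial_subset {1..n} p; return_pmf (G \<union> nsets V 2)}"
proof -
  let ?A = "{1..n}" and ?\<beta> = "\<lambda>_::nat. bernoulli_pmf p" and ?\<sigma> = "\<lambda>_::nat. binomial_subset {1..m} p"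
  have ins: "{1..Suc m} = insert (Suc m) {1..m}" "Suc m \<notin> {1..m}" by auto
  \<comment> \<open>Drawing in two stages at every vertex is the same as drawing two independent
    families, with dummy values \<open>False\<close> and \<open>{}\<close>.\<close>
  have "Pi_pmf ?A {} (\<lambda>_. binomial_subset {1..Suc m} p)
      = do {B \<leftarrow> Pi_pmf ?A False ?\<beta>; L \<leftarrow> Pi_pmf ?A {} ?\<sigma>;
            return_pmf (\<lambda>i. if i \<in> ?A then if B i then insert (Suc m) (L i) else L i else {})}"
    unfolding ins(1) binomial_subset_insert[OF finite_atLeastAtMost ins(2)]
    by (simp add: Pi_pmf_bind[where d' = False] Pi_pmf_bind[where d' = "{}"])
  then have "random_intersection_graph n (Suc m) p
      = do {B \<leftarrow> Pi_pmf ?A False ?\<beta>; L \<leftarrow> Pi_pmf ?A {} ?\<sigma>;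
            return_pmf (intersection_graph n (\<lambda>i. if i \<in> ?A then if B i then insert (Suc m) (L i) else L i else {}))}"
    by (simp add: random_intersection_graph_def map_bind_pmf)
  also have "\<dots> = do {B \<leftarrow> Pi_pmf ?A False ?\<beta>; L \<leftarrow> Pi_pmf ?A {} ?\<sigma>;
            return_pmf (intersection_graph n L \<union> nsets {i \<in> ?A. B i} 2)}"
  proof (intro bind_pmf_cong refl arg_cong[where f = return_pmf] intersection_graph_add_element)
    fix L i assume "L \<in> set_pmf (Pi_pmf ?A {} ?\<sigma>)" "i \<in> ?A"
    then have "L i \<in> set_pmf (binomial_subset {1..m} p)"
      by (auto simp: set_Pi_pmf PiE_dflt_def)
    then have "L i \<subseteq> {1..m}"
      using set_binomial_subset[of "{1..m}" p] by blast
    then show "Suc m \<notin> L i" by auto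
  qed
  also have "\<dots> = do {L \<leftarrow> Pi_pmf ?A {} ?\<sigma>; B \<leftarrow> Pi_pmf ?A False ?\<beta>;
            return_pmf (intersection_graph n L \<union> nsets {i \<in> ?A. B i} 2)}"
    by (rule bind_commute_pmf)
  finally show ?thesis
    by (simp add: random_intersection_graph_def binomial_subset_def bind_map_pmf)
qed

section \<open>Remainders of truncated expansions over subsets\<close>

text \<open>The Moebius expansion of \<open>\<Phi> (nsets V 2)\<close> over subsets of
  \<open>V\<close>, cut off after the triples. It is exact for at most three vertices. From four
  vertices on, the crude bound on each term is at most a multiple of the number of 4-subsets, whose
  mean carries the factor \<open>p ^ 4\<close>.\<close>

lemma moebius_remainder_le:
  fixes \<Phi> :: "'a set set \<Rightarrow> real" and B :: real
  assumes "finite V" and \<Phi>: "\<And>U. U \<subseteq> nsets V 2 \<Longrightarrow> \<bar>\<Phi> U\<bar> \<le> B * card U" and "0 \<le> B"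
  shows "\<bar>\<Phi> (nsets V 2) - (\<Sum>e\<in>nsets V 2. \<Phi> {e})
           - (\<Sum>t\<in>nsets V 3. \<Phi> (nsets t 2) - (\<Sum>e\<in>nsets t 2. \<Phi> {e}))\<bar>
       \<le> 36 * B * real (card V choose 4)"
proof -
  define D where "D t = \<Phi> (nsets t 2) - (\<Sum>e\<in>nsets t 2. \<Phi> {e})" for t
  have D: "\<bar>D t\<bar> \<le> 2 * B * real (card t choose 2)" if "t \<subseteq> V" for t
  proof -
    have sub: "nsets t 2 \<subseteq> nsets V 2" using that by (rule nsets_mono)
    have "\<bar>\<Sum>e\<in>nsets t 2. \<Phi> {e}\<bar> \<le> (\<Sum>e\<in>nsets t 2. B)"
    proof (rule order_trans[OF sum_abs sum_mono])
      fix e assume "e \<in> nsets t 2"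
      then show "\<bar>\<Phi> {e}\<bar> \<le> B" using \<Phi>[of "{e}"] sub by auto
    qed
    moreover have "\<bar>\<Phi> (nsets t 2)\<bar> \<le> B * real (card t choose 2)"
      using \<Phi>[OF sub] by simp
    ultimately show ?thesis
      unfolding D_def by (simp add: mult.commute)
  qed
  have single: "nsets V k = {V}" if "card V = k" for k
    using that assms(1) card_subset_eq[of V] by (auto simp: nsets_def)
  consider "card V < 2" | "card V = 2" | "card V = 3" | "4 \<le> card V" by linarith
  then have "\<bar>D V - (\<Sum>t\<in>nsets V 3. D t)\<bar> \<le> 36 * B * real (card V choose 4)"
  proof cases
    case 1
    then have "D V = 0" "nsets V 3 = {}"
      using D[of V] assms by (auto simp: nsets_eq_empty binomial_eq_0)
    then show ?thesis using assms by simp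
  next
    case 2
    then have "D V = 0" "nsets V 3 = {}"
      using assms by (auto simp: nsets_eq_empty D_def single)
    then show ?thesis using assms by simp
  next
    case 3
    then show ?thesis using assms by (simp add: single)
  next
    case 4
    have "\<bar>\<Sum>t\<in>nsets V 3. D t\<bar> \<le> (\<Sum>t\<in>nsets V 3. 6 * B)"
    proof (rule order_trans[OF sum_abs sum_mono])
      fix t assume "t \<in> nsets V 3"
      then show "\<bar>D t\<bar> \<le> 6 * B" using D[of t] by (auto simp: nsets_def choose_two)
    qed
    then have "\<bar>D V - (\<Sum>t\<in>nsets V 3. D t)\<bar>
        \<le> 2 * B * real (card V choose 2) + 6 * B * real (card V choose 3)"
      using D[of V] by (simp add: mult.commute)
    \<comment> \<open>For at least four vertices,
      \<open>2 * (card V choose 2) \<le> 3 * (card V choose 3)\<close> and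
      \<open>card V choose 3 \<le> 4 * (card V choose 4)\<close>. The total is at most 9 times the
      number of triples, hence 36 times the number of 4-subsets.\<close>
    also have "\<dots> \<le> 36 * B * real (card V choose 4)"
    proof -
      have "3 * (card V choose 3) = (card V choose 2) * (card V - 2)"
        using binomial_absorb_comp[of "card V" 2] binomial_absorption[of 2 "card V"]
        by (simp add: eval_nat_numeral mult.commute)
      also have "\<dots> \<ge> (card V choose 2) * 2" using 4 by (intro mult_left_mono) auto
      finally have c2: "2 * (card V choose 2) \<le> 3 * (card V choose 3)" by simp
      have "4 * (card V choose 4) = (card V choose 3) * (card V - 3)"
        using binomial_absorb_comp[of "card V" 3] binomial_absorption[of 3 "card V"]
        by (simp add: eval_nat_numeral mult.commute)
      also have "\<dots> \<ge> (card V choose 3) * 1" using 4 by (intro mult_left_mono) auto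
      finally have c3: "card V choose 3 \<le> 4 * (card V choose 4)" by simp
      have "2 * (card V choose 2) + 6 * (card V choose 3) \<le> 36 * (card V choose 4)"
        using c2 c3 by linarith
      then have "2 * real (card V choose 2) + 6 * real (card V choose 3) \<le> 36 * real (card V choose 4)"
        by (metis (mono_tags) of_nat_add of_nat_le_iff of_nat_mult of_nat_numeral)
      from mult_left_mono[OF this assms(3)] show ?thesis by (simp add: algebra_simps)
    qed
    finally show ?thesis .
  qed
  then show ?thesis by (simp add: D_def)
qed

text \<open>The analogue for independent edges, cut off after the single edges: it is exact for at
  most one edge, and otherwise the number of edges is at most twice the number of pairs of
  edges.\<close>

lemma linear_remainder_le:
  fixes \<Phi> :: "'a set \<Rightarrow> real" and B :: real
  assumes "finite U" and \<Phi>: "\<And>U'. U' \<subseteq> U \<Longrightarrow> \<bar>\<Phi> U'\<bar> \<le> B * card U'" and "0 \<le> B"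
  shows "\<bar>\<Phi> U - (\<Sum>e\<in>U. \<Phi> {e})\<bar> \<le> 4 * B * real (card U choose 2)"
proof -
  consider "card U = 0" | "card U = 1" | "2 \<le> card U" by linarith
  then show ?thesis
  proof cases
    case 1
    then show ?thesis using assms by auto
  next
    case 2
    then obtain e where "U = {e}" by (auto simp: card_1_singleton_iff)
    then show ?thesis using assms by simp
  next
    case 3
    have "\<bar>\<Sum>e\<in>U. \<Phi> {e}\<bar> \<le> (\<Sum>e\<in>U. B)"
    proof (rule order_trans[OF sum_abs sum_mono])
      fix e assume "e \<in> U"
      then show "\<bar>\<Phi> {e}\<bar> \<le> B" using \<Phi>[of "{e}"] by auto
    qed
    then have "\<bar>\<Phi> U - (\<Sum>e\<in>U. \<Phi> {e})\<bar> \<le> 2 * (B * card U)"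
      using \<Phi>[of U] by (simp add: mult.commute[of _ B])
    also have "\<dots> \<le> 4 * B * real (card U choose 2)"
    proof -
      have "even (card U * (card U - 1))" by (cases "card U") auto
      then have "2 * (card U choose 2) = card U * (card U - 1)"
        by (simp add: choose_two)
      also have "\<dots> \<ge> card U * 1" using 3 by (intro mult_left_mono) auto
      finally have "card U \<le> 2 * (card U choose 2)" by simp
      then have "real (card U) \<le> 2 * real (card U choose 2)"
        by (metis (mono_tags) of_nat_le_iff of_nat_mult of_nat_numeral)
      from mult_left_mono[OF this assms(3)] show ?thesis by (simp add: algebra_simps)
    qed
    finally show ?thesis .
  qed
qed

section \<open>Replacing cliques by independent edges\<close>

text \<open>The hybrid law of the replacement argument: \<open>k\<close> cliques have been replaced
  and \<open>j\<close> remain. The \<open>k\<close> edge layers of density \<open>p\<^sup>2\<close>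
  are stored merged into one binomial set.\<close>

definition mixed_graph :: "nat \<Rightarrow> real \<Rightarrow> nat \<Rightarrow> nat \<Rightarrow> nat set set pmf" where
  "mixed_graph n p k j =
     do {Y \<leftarrow> binomial_subset (vertex_pairs n) (1 - (1 - p\<^sup>2) ^ k);
         Z \<leftarrow> random_intersection_graph n j p; return_pmf (Y \<union> Z)}"

lemma finite_set_mixed_graph [simp]: "finite (set_pmf (mixed_graph n p k j))"
  by (auto simp: mixed_graph_def)

lemma expectation_mixed_graph:
  fixes h :: "nat set set \<Rightarrow> real"
  shows "measure_pmf.expectation (mixed_graph n p k j) h
    = measure_pmf.expectation (binomial_subset (vertex_pairs n) (1 - (1 - p\<^sup>2) ^ k))
        (\<lambda>Y. measure_pmf.expectation (random_intersection_graph n j p) (\<lambda>Z. h (Y \<union> Z)))"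
  by (simp add: mixed_graph_def expectation_bind_finite)

lemma binomial_subset_0: "finite S \<Longrightarrow> binomial_subset S 0 = return_pmf {}"
proof (induction S rule: finite_induct)
  case (insert x S)
  have "bernoulli_pmf 0 = return_pmf False"
    by (rule pmf_eqI) (auto simp: indicator_def split: if_splits; metis (full_types) pmf_bernoulli_False pmf_bernoulli_True order_refl zero_le_one diff_zero)
  with insert show ?case
    by (simp add: binomial_subset_insert bind_return_pmf)
qed simp

lemma mixed_graph_0_left: "mixed_graph n p 0 m = random_intersection_graph n m p"
  by (simp add: mixed_graph_def binomial_subset_0 bind_return_pmf bind_return_pmf')

lemma mixed_graph_0_right: "mixed_graph n p m 0 = erdos_renyi_graph n (1 - (1 - p\<^sup>2) ^ m)"
  by (simp add: mixed_graph_def random_intersection_graph_0 erdos_renyi_graph_def bind_return_pmf bind_return_pmf')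

lemma expectation_random_intersection_graph_Suc:
  fixes h :: "nat set set \<Rightarrow> real"
  shows "measure_pmf.expectation (random_intersection_graph n (Suc m) p) h
    = measure_pmf.expectation (random_intersection_graph n m p)
        (\<lambda>G. measure_pmf.expectation (binomial_subset {1..n} p) (\<lambda>V. h (G \<union> nsets V 2)))"
  by (simp add: random_intersection_graph_Suc expectation_bind_finite)

section \<open>The effect of planting edges in a mixed graph\<close>

context
  fixes p :: real and n :: nat
  assumes p: "0 \<le> p" "p \<le> 1"
begin

lemma square_prob: "0 \<le> p\<^sup>2" "p\<^sup>2 \<le> 1" "0 \<le> 1 - (1 - p\<^sup>2) ^ k" "1 - (1 - p\<^sup>2) ^ k \<le> 1"
  using p by (auto simp: power_le_one abs_square_le_1)

lemma expectation_random_intersection_graph_nonedge: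
  assumes "e \<in> vertex_pairs n"
  shows "measure_pmf.expectation (random_intersection_graph n m p) (\<lambda>G. of_bool (e \<notin> G)) = (1 - p\<^sup>2) ^ m"
proof (induction m)
  case (Suc m)
  have e: "e \<subseteq> {1..n}" "finite e" "card e = 2"
    using assms by (auto simp: vertex_pairs_eq_nsets nsets_def)
  have split: "of_bool (e \<notin> G \<union> nsets V 2) = of_bool (e \<notin> G) * (1 - of_bool (e \<subseteq> V) :: real)" for G V
    using e by (auto simp: nsets_def)
  show ?case
    unfolding expectation_random_intersection_graph_Suc split
    using e p by (simp add: Suc.IH expectation_binomial_subset_superset)
qed (simp add: random_intersection_graph_0)

text \<open>A clique and an edge layer both miss \<open>e\<close> with probability
  \<open>1 - p\<^sup>2\<close>, independently over all layers. Replacements thus leave edge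
  probabilities unchanged.\<close>

lemma expectation_mixed_graph_nonedge:
  assumes "e \<in> vertex_pairs n"
  shows "measure_pmf.expectation (mixed_graph n p k j) (\<lambda>G. of_bool (e \<notin> G)) = (1 - p\<^sup>2) ^ (k + j)"
proof -
  have "of_bool (e \<notin> Y) = (1 - of_bool ({e} \<subseteq> Y) :: real)" for Y by auto
  then have "measure_pmf.expectation (binomial_subset (vertex_pairs n) (1 - (1 - p\<^sup>2) ^ k)) (\<lambda>Y. of_bool (e \<notin> Y)) = (1 - p\<^sup>2) ^ k"
    using assms expectation_binomial_subset_superset[OF square_prob(3,4)[of k] finite_vertex_pairs, of "{e}"]
    by (simp del: insert_subset) simp
  moreover have "of_bool (e \<notin> Y \<union> Z) = (of_bool (e \<notin> Y) * of_bool (e \<notin> Z) :: real)" for Y Z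
    by auto
  ultimately show ?thesis
    by (simp add: expectation_mixed_graph expectation_random_intersection_graph_nonedge[OF assms] power_add del: Un_iff)
qed

context
  fixes h :: "nat set set \<Rightarrow> real"
  assumes h: "\<And>G. \<bar>h G\<bar> \<le> 1"
begin

definition gain :: "nat \<Rightarrow> nat \<Rightarrow> nat set set \<Rightarrow> real" where
  "gain k j U = measure_pmf.expectation (mixed_graph n p k j) (\<lambda>X. h (X \<union> U))
              - measure_pmf.expectation (mixed_graph n p k j) h"

text \<open>Planting \<open>U\<close> matters only if an edge of \<open>U\<close> is missing, and
  then changes \<open>h\<close> by at most 2; a union bound over \<open>U\<close> finishes. The
  decaying factor is later traded against powers of \<open>p\<close>.\<close>

lemma gain_le:
  assumes "U \<subseteq> vertex_pairs n"
  shows "\<bar>gain k j U\<bar> \<le> 2 * (1 - p\<^sup>2) ^ (k + j) * real (card U)"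
proof -
  let ?M = "mixed_graph n p k j"
  have fin: "finite U" using finite_subset[OF assms] by simp
  have int: "integrable (measure_pmf ?M) f" for f :: "nat set set \<Rightarrow> real"
    by (simp add: integrable_measure_pmf_finite)
  have "\<bar>gain k j U\<bar> = \<bar>measure_pmf.expectation ?M (\<lambda>X. h (X \<union> U) - h X)\<bar>"
    by (simp add: gain_def int)
  also have "\<dots> \<le> measure_pmf.expectation ?M (\<lambda>X. \<bar>h (X \<union> U) - h X\<bar>)"
    by (rule integral_abs_bound)
  also have "\<dots> \<le> measure_pmf.expectation ?M (\<lambda>X. 2 * (\<Sum>e\<in>U. of_bool (e \<notin> X)))"
  proof (rule expectation_mono_finite)
    fix X
    show "\<bar>h (X \<union> U) - h X\<bar> \<le> 2 * (\<Sum>e\<in>U. of_bool (e \<notin> X))"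
    proof (cases "U \<subseteq> X")
      case True
      then have "X \<union> U = X" by auto
      then show ?thesis by (simp add: sum_nonneg)
    next
      case False
      then obtain e where "e \<in> U" "e \<notin> X" by auto
      then have "1 \<le> (\<Sum>e\<in>U. of_bool (e \<notin> X) :: real)"
        using fin member_le_sum[of e U "\<lambda>e. of_bool (e \<notin> X) :: real"] by auto
      then show ?thesis
        using h[of X] h[of "X \<union> U"] by linarith
    qed
  qed simp
  also have "\<dots> = 2 * (\<Sum>e\<in>U. measure_pmf.expectation ?M (\<lambda>X. of_bool (e \<notin> X)))"
    by (simp add: int)
  also have "\<dots> = 2 * (1 - p\<^sup>2) ^ (k + j) * real (card U)"
    using assms by (simp add: expectation_mixed_graph_nonedge subset_iff)
  finally show ?thesis .
qed

lemma expectation_mixed_graph_Suc_right: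
  "measure_pmf.expectation (mixed_graph n p k (Suc j)) h
   = measure_pmf.expectation (mixed_graph n p k j) h
     + measure_pmf.expectation (binomial_subset {1..n} p) (\<lambda>V. gain k j (nsets V 2))"
proof -
  have "measure_pmf.expectation (mixed_graph n p k (Suc j)) h
      = measure_pmf.expectation (mixed_graph n p k j)
          (\<lambda>X. measure_pmf.expectation (binomial_subset {1..n} p) (\<lambda>V. h (X \<union> nsets V 2)))"
    by (simp add: expectation_mixed_graph expectation_random_intersection_graph_Suc Un_assoc)
  also have "\<dots> = measure_pmf.expectation (binomial_subset {1..n} p)
          (\<lambda>V. measure_pmf.expectation (mixed_graph n p k j) (\<lambda>X. h (X \<union> nsets V 2)))"
    by (rule expectation_swap_finite) auto
  finally show ?thesis by (simp add: gain_def)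
qed

text \<open>The extra edge layer is split off from the merged one. A new clique and a new layer are
  then measured by the same \<open>gain k j\<close>, and the cost of a replacement is the difference
  of the two means.\<close>

lemma expectation_mixed_graph_Suc_left:
  "measure_pmf.expectation (mixed_graph n p (Suc k) j) h
   = measure_pmf.expectation (mixed_graph n p k j) h
     + measure_pmf.expectation (binomial_subset (vertex_pairs n) (p\<^sup>2)) (gain k j)"
proof -
  let ?E = "vertex_pairs n" and ?Z = "random_intersection_graph n j p"
  have "1 - (1 - p\<^sup>2) ^ Suc k = 1 - (1 - (1 - (1 - p\<^sup>2) ^ k)) * (1 - p\<^sup>2)" by simp
  then have "measure_pmf.expectation (mixed_graph n p (Suc k) j) h
      = measure_pmf.expectation (binomial_subset ?E (1 - (1 - p\<^sup>2) ^ k))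
         (\<lambda>Y. measure_pmf.expectation (binomial_subset ?E (p\<^sup>2))
            (\<lambda>U. measure_pmf.expectation ?Z (\<lambda>Z. h (Y \<union> U \<union> Z))))"
    unfolding expectation_mixed_graph
    by (simp only: expectation_binomial_subset_union finite_vertex_pairs square_prob)
  also have "\<dots> = measure_pmf.expectation (binomial_subset ?E (p\<^sup>2))
        (\<lambda>U. measure_pmf.expectation (binomial_subset ?E (1 - (1 - p\<^sup>2) ^ k))
            (\<lambda>Y. measure_pmf.expectation ?Z (\<lambda>Z. h (Y \<union> U \<union> Z))))"
    by (rule expectation_swap_finite) auto
  also have "\<dots> = measure_pmf.expectation (binomial_subset ?E (p\<^sup>2))
        (\<lambda>U. measure_pmf.expectation (mixed_graph n p k j) (\<lambda>X. h (X \<union> U)))"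
    by (simp add: expectation_mixed_graph Un_ac)
  finally show ?thesis by (simp add: gain_def[abs_def])
qed

text \<open>The third-order coefficient of the expansion: what planting a triangle does beyond
  planting its edges separately, summed over all triangles.\<close>

definition triangle_gain :: "nat \<Rightarrow> nat \<Rightarrow> real" where
  "triangle_gain k j = (\<Sum>t\<in>nsets {1..n} 3. gain k j (nsets t 2) - (\<Sum>e\<in>nsets t 2. gain k j {e}))"

text \<open>Average the truncated expansion over the random vertex set: edges, triangles and
  4-subsets bring \<open>p\<^sup>2\<close>, \<open>p ^ 3\<close> and \<open>p ^ 4\<close>.\<close>

lemma expectation_gain_clique:
  "\<bar>measure_pmf.expectation (binomial_subset {1..n} p) (\<lambda>V. gain k j (nsets V 2))
     - p\<^sup>2 * (\<Sum>e\<in>vertex_pairs n. gain k j {e}) - p ^ 3 * triangle_gain k j\<bar>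
   \<le> 72 * (1 - p\<^sup>2) ^ (k + j) * real (n choose 4) * p ^ 4"
proof -
  let ?B = "binomial_subset {1..n} p"
  define c where "c = 2 * (1 - p\<^sup>2) ^ (k + j)"
  have c: "0 \<le> c" using square_prob by (simp add: c_def)
  define D where "D t = gain k j (nsets t 2) - (\<Sum>e\<in>nsets t 2. gain k j {e})" for t
  have "measure_pmf.expectation ?B (\<lambda>V. \<Sum>e\<in>nsets V 2. gain k j {e})
      = p\<^sup>2 * (\<Sum>e\<in>vertex_pairs n. gain k j {e})"
    using expectation_binomial_subset_nsets[OF p, where S = "{1..n}" and c = "\<lambda>e. gain k j {e}" and k = 2]
    by (simp add: vertex_pairs_eq_nsets)
  moreover have "measure_pmf.expectation ?B (\<lambda>V. \<Sum>t\<in>nsets V 3. D t) = p ^ 3 * triangle_gain k j"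
    using expectation_binomial_subset_nsets[OF p, where S = "{1..n}" and c = D and k = 3]
    by (simp add: triangle_gain_def D_def)
  ultimately have "\<bar>measure_pmf.expectation ?B (\<lambda>V. gain k j (nsets V 2))
     - p\<^sup>2 * (\<Sum>e\<in>vertex_pairs n. gain k j {e}) - p ^ 3 * triangle_gain k j\<bar>
    = \<bar>measure_pmf.expectation ?B (\<lambda>V. gain k j (nsets V 2) - (\<Sum>e\<in>nsets V 2. gain k j {e}) - (\<Sum>t\<in>nsets V 3. D t))\<bar>"
    by simp
  also have "\<dots> \<le> measure_pmf.expectation ?B (\<lambda>V. \<bar>gain k j (nsets V 2) - (\<Sum>e\<in>nsets V 2. gain k j {e}) - (\<Sum>t\<in>nsets V 3. D t)\<bar>)"
    by (rule integral_abs_bound)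
  \<comment> \<open>The binomial coefficient is written as a sum of ones over 4-subsets so that its
    mean can be read off.\<close>
  also have "\<dots> \<le> measure_pmf.expectation ?B (\<lambda>V. 36 * c * (\<Sum>t\<in>nsets V 4. 1))"
  proof (rule expectation_mono_finite)
    fix V assume "V \<in> set_pmf ?B"
    then have V: "V \<subseteq> {1..n}" using set_binomial_subset[of "{1..n}" p] by auto
    then have "nsets V 2 \<subseteq> vertex_pairs n" by (simp add: vertex_pairs_eq_nsets nsets_mono)
    moreover have "finite V" using V finite_subset by blast
    ultimately show "\<bar>gain k j (nsets V 2) - (\<Sum>e\<in>nsets V 2. gain k j {e}) - (\<Sum>t\<in>nsets V 3. D t)\<bar>
        \<le> 36 * c * (\<Sum>t\<in>nsets V 4. 1)"
      unfolding D_def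
      using moebius_remainder_le[of V "gain k j" c] gain_le c by (auto simp: c_def)
  qed simp
  also have "\<dots> = 36 * c * (p ^ 4 * (\<Sum>t\<in>nsets {1..n} 4. 1))"
    by (simp only: integral_mult_right_zero expectation_binomial_subset_nsets[OF p finite_atLeastAtMost])
  also have "\<dots> = 72 * (1 - p\<^sup>2) ^ (k + j) * real (n choose 4) * p ^ 4"
    by (simp add: c_def)
  finally show ?thesis .
qed

text \<open>The first-order term agrees with that of the clique, so it cancels in a replacement. The
  error comes from pairs of edges, each present with probability
  \<open>(p\<^sup>2)\<^sup>2\<close>.\<close>

lemma expectation_gain_edges:
  "\<bar>measure_pmf.expectation (binomial_subset (vertex_pairs n) (p\<^sup>2)) (gain k j)
     - p\<^sup>2 * (\<Sum>e\<in>vertex_pairs n. gain k j {e})\<bar>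
   \<le> 8 * (1 - p\<^sup>2) ^ (k + j) * real ((n choose 2) choose 2) * p ^ 4"
proof -
  let ?B = "binomial_subset (vertex_pairs n) (p\<^sup>2)"
  define c where "c = 2 * (1 - p\<^sup>2) ^ (k + j)"
  have c: "0 \<le> c" using square_prob by (simp add: c_def)
  have single: "(\<Sum>t\<in>nsets U 1. gain k j t) = (\<Sum>e\<in>U. gain k j {e})" for U
    by (simp add: nsets_one sum.reindex)
  have "measure_pmf.expectation ?B (\<lambda>U. \<Sum>e\<in>U. gain k j {e}) = p\<^sup>2 * (\<Sum>e\<in>vertex_pairs n. gain k j {e})"
    using expectation_binomial_subset_nsets[OF square_prob(1,2) finite_vertex_pairs, where c = "gain k j" and k = 1]
    unfolding single by simp
  then have "\<bar>measure_pmf.expectation ?B (gain k j) - p\<^sup>2 * (\<Sum>e\<in>vertex_pairs n. gain k j {e})\<bar>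
      = \<bar>measure_pmf.expectation ?B (\<lambda>U. gain k j U - (\<Sum>e\<in>U. gain k j {e}))\<bar>"
    by simp
  also have "\<dots> \<le> measure_pmf.expectation ?B (\<lambda>U. \<bar>gain k j U - (\<Sum>e\<in>U. gain k j {e})\<bar>)"
    by (rule integral_abs_bound)
  also have "\<dots> \<le> measure_pmf.expectation ?B (\<lambda>U. 4 * c * (\<Sum>t\<in>nsets U 2. 1))"
  proof (rule expectation_mono_finite)
    fix U assume "U \<in> set_pmf ?B"
    then have U: "U \<subseteq> vertex_pairs n" using set_binomial_subset[OF finite_vertex_pairs] by blast
    then have "finite U" using finite_subset[OF U] by simp
    then show "\<bar>gain k j U - (\<Sum>e\<in>U. gain k j {e})\<bar> \<le> 4 * c * (\<Sum>t\<in>nsets U 2. 1)"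
      using linear_remainder_le[of U "gain k j" c] gain_le c U by (auto simp: c_def)
  qed simp
  also have "\<dots> = 4 * c * ((p\<^sup>2)\<^sup>2 * (\<Sum>t\<in>nsets (vertex_pairs n) 2. 1))"
    by (simp only: integral_mult_right_zero expectation_binomial_subset_nsets[OF square_prob(1,2) finite_vertex_pairs])
  also have "\<dots> = 8 * (1 - p\<^sup>2) ^ (k + j) * real ((n choose 2) choose 2) * p ^ 4"
    by (simp add: c_def vertex_pairs_eq_nsets)
  finally show ?thesis .
qed

text \<open>The trivial estimate: a triangle and its three separate edges involve six single-edge
  bounds of \<open>2 * (1 - p\<^sup>2) ^ (k + j)\<close>.\<close>

lemma triangle_gain_le_coverage:
  "\<bar>triangle_gain k j\<bar> \<le> 12 * (1 - p\<^sup>2) ^ (k + j) * real (n choose 3)"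
proof -
  let ?c = "2 * (1 - p\<^sup>2) ^ (k + j)"
  have "\<bar>gain k j (nsets t 2) - (\<Sum>e\<in>nsets t 2. gain k j {e})\<bar> \<le> 6 * ?c" if "t \<in> nsets {1..n} 3" for t
  proof -
    have t: "nsets t 2 \<subseteq> vertex_pairs n" "card (nsets t 2) = 3"
    proof -
      have "t \<subseteq> {1..n}" "card t = 3" using that unfolding nsets_def by auto
      then show "nsets t 2 \<subseteq> vertex_pairs n" "card (nsets t 2) = 3"
        unfolding vertex_pairs_eq_nsets by (auto intro: nsets_mono[THEN subsetD] simp: choose_two)
    qed
    have "\<bar>\<Sum>e\<in>nsets t 2. gain k j {e}\<bar> \<le> (\<Sum>e\<in>nsets t 2. ?c)"
    proof (rule order_trans[OF sum_abs sum_mono])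
      fix e assume "e \<in> nsets t 2"
      then show "\<bar>gain k j {e}\<bar> \<le> ?c" using gain_le[of "{e}" k j] t(1) by auto
    qed
    then have "\<bar>\<Sum>e\<in>nsets t 2. gain k j {e}\<bar> \<le> 3 * ?c"
      using t(2) by simp
    moreover have "\<bar>gain k j (nsets t 2)\<bar> \<le> 3 * ?c"
      using gain_le[OF t(1), of k j] t(2) by simp
    ultimately show ?thesis by linarith
  qed
  then have "\<bar>triangle_gain k j\<bar> \<le> (\<Sum>t\<in>nsets {1..n} 3. 6 * ?c)"
    unfolding triangle_gain_def by (intro order_trans[OF sum_abs sum_mono])
  then show ?thesis by (simp add: mult_ac)
qed

text \<open>Averaging over the remaining cliques turns \<open>h\<close> into a test function of the
  binomial layer alone, still bounded by 1, to which the orthogonality bound applies.\<close>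

lemma triangle_gain_le_smoothing:
  assumes "0 < q" "q = 1 - (1 - p\<^sup>2) ^ k"
  shows "\<bar>triangle_gain k j\<bar>
      \<le> sqrt (real (n choose 3) * (3 * ((1 - q) / q)\<^sup>2 + ((1 - q) / q) ^ 3))"
proof -
  let ?Z = "random_intersection_graph n j p"
  define g where "g Y = measure_pmf.expectation ?Z (\<lambda>Z. h (Y \<union> Z))" for Y
  have "\<bar>g Y\<bar> \<le> 1" for Y
  proof -
    have "\<bar>g Y\<bar> \<le> measure_pmf.expectation ?Z (\<lambda>Z. \<bar>h (Y \<union> Z)\<bar>)"
      unfolding g_def by (rule integral_abs_bound)
    also have "\<dots> \<le> measure_pmf.expectation ?Z (\<lambda>Z. 1)"
      using h by (intro expectation_mono_finite) auto
    finally show ?thesis by simp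
  qed
  moreover have "gain k j U = measure_pmf.expectation (binomial_subset (nsets {1..n} 2) q) (\<lambda>Y. g (Y \<union> U))
             - measure_pmf.expectation (binomial_subset (nsets {1..n} 2) q) g" for U
    unfolding gain_def g_def expectation_mixed_graph assms(2)
    by (simp add: vertex_pairs_eq_nsets Un_ac)
  ultimately show ?thesis
    using expectation_planted_triangles[of "{1..n}" q g] assms square_prob(4)[of k]
    by (simp add: triangle_gain_def)
qed

end

end

section \<open>Summing the replacement errors\<close>

lemma quadratic_le_power:
  fixes s :: real
  assumes "0 \<le> s"
  shows "1 + real k * s + real k * (real k - 1) / 2 * s\<^sup>2 \<le> (1 + s) ^ k"
proof (induction k)
  case (Suc k)
  have "1 + real (Suc k) * s + real (Suc k) * (real (Suc k) - 1) / 2 * s\<^sup>2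
      \<le> (1 + s) * (1 + real k * s + real k * (real k - 1) / 2 * s\<^sup>2)"
  proof -
    \<comment> \<open>The product on the right exceeds the left side by exactly
      \<open>real k * (real k - 1) / 2 * s ^ 3\<close>.\<close>
    have "0 \<le> real k * (real k - 1)" by (cases k) auto
    then have "0 \<le> real k * (real k - 1) / 2 * s ^ 3" using assms by (intro mult_nonneg_nonneg) auto
    then show ?thesis by (simp add: field_simps power2_eq_square power3_eq_cube)
  qed
  also have "\<dots> \<le> (1 + s) * (1 + s) ^ k"
    using Suc.IH assms by (intro mult_left_mono) auto
  finally show ?case by simp
qed simp

text \<open>Since \<open>(1 - s) * (1 + s) \<le> 1\<close>. It bounds \<open>(1 - s) ^ k\<close> by
  the inverse of its linear and of its quadratic term at once.\<close>

lemma power_one_minus_times_quadratic_le: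
  fixes s :: real
  assumes "0 \<le> s" "s \<le> 1"
  shows "(1 - s) ^ k * (1 + real k * s + real k * (real k - 1) / 2 * s\<^sup>2) \<le> 1"
proof -
  have "(1 - s) ^ k * (1 + real k * s + real k * (real k - 1) / 2 * s\<^sup>2) \<le> (1 - s) ^ k * (1 + s) ^ k"
    using assms by (intro mult_left_mono quadratic_le_power) auto
  also have "\<dots> = (1 - s\<^sup>2) ^ k"
    by (simp add: power_mult_distrib[symmetric] algebra_simps power2_eq_square)
  also have "\<dots> \<le> 1"
    using assms by (intro power_le_one) (auto simp: abs_square_le_1)
  finally show ?thesis .
qed

lemma nonneg_quadratic_coeff: "0 \<le> real k * (real k - 1)"
  by (cases k) auto

text \<open>Bounds the second moment of a corrected triangle density times \<open>s ^ 3\<close>, the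
  square of the prefactor \<open>p ^ 3\<close> when \<open>s = p\<^sup>2\<close>. From
  \<open>k = 2\<close> on, \<open>real k - 1\<close> is at least \<open>real k / 2\<close>, so the
  quadratic term is of order \<open>(real k * s)\<^sup>2\<close>.\<close>

lemma odds_ratio_moments_le:
  fixes s :: real
  assumes s: "0 < s" "s \<le> 1" and k: "2 \<le> k"
  defines "q \<equiv> 1 - (1 - s) ^ k"
  shows "0 < q" "s ^ 3 * (3 * ((1 - q) / q)\<^sup>2 + ((1 - q) / q) ^ 3) \<le> 13 / real k ^ 3"
proof -
  have "(1 - s) ^ k \<le> (1 - s) ^ 1" using s k by (intro power_decreasing) auto
  with s show q: "0 < q" by (simp add: q_def)
  define u where "u = real k * s + real k * (real k - 1) / 2 * s\<^sup>2"
  define r where "r = (1 - q) / q"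
  have u: "real k * s \<le> u" "real k * (real k - 1) / 2 * s\<^sup>2 \<le> u"
    using s nonneg_quadratic_coeff[of k] by (auto simp: u_def)
  have r0: "0 \<le> r" using s q by (simp add: r_def q_def)
  have "(1 - q) * (1 + u) \<le> 1"
    using power_one_minus_times_quadratic_le[of s k] s by (simp add: q_def u_def add.assoc)
  then have ru: "r * u \<le> 1" using q by (simp add: r_def field_simps)
  \<comment> \<open>Multiplying the linear by the quadratic bound on \<open>r\<close> makes the estimate independent of \<open>s\<close>.\<close>
  have 1: "r * (real k * s) \<le> 1"
    using mult_left_mono[OF u(1) r0] ru by linarith
  have 2: "r * (real k * (real k - 1) / 2 * s\<^sup>2) \<le> 1"
    using mult_left_mono[OF u(2) r0] ru by linarith
  have k2: "real k / 2 \<le> real k - 1" using k by simp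
  have "r * (real k * (real k / 2) / 2 * s\<^sup>2) \<le> r * (real k * (real k - 1) / 2 * s\<^sup>2)"
    using k2 r0 s by (intro mult_left_mono mult_right_mono divide_right_mono) auto
  moreover have "r * ((real k)\<^sup>2 * s\<^sup>2) = 4 * (r * (real k * (real k / 2) / 2 * s\<^sup>2))"
    by (simp add: power2_eq_square)
  ultimately have 2: "r * ((real k)\<^sup>2 * s\<^sup>2) \<le> 4"
    using 2 by linarith
  have "(r * (real k * s)) * (r * ((real k)\<^sup>2 * s\<^sup>2)) \<le> 1 * 4"
    using r0 s by (intro mult_mono 1 2) auto
  moreover have "(r * (real k * s)) ^ 3 \<le> 1 ^ 3"
    using r0 s by (intro power_mono 1) auto
  \<comment> \<open>13 = 3 * 4 + 1: the mixed product is counted three times, the cube of the linear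
    bound once.\<close>
  ultimately have "real k ^ 3 * (s ^ 3 * (3 * r\<^sup>2 + r ^ 3)) \<le> 13"
    by (simp add: power2_eq_square power3_eq_cube algebra_simps)
  then show "s ^ 3 * (3 * ((1 - q) / q)\<^sup>2 + ((1 - q) / q) ^ 3) \<le> 13 / real k ^ 3"
    using k by (simp add: r_def[symmetric] field_simps)
qed

text \<open>With \<open>s = p\<^sup>2\<close>, the fourth power needs the quadratic bound, and the
  third power is the geometric mean of the linear and the quadratic one. The exponent is
  \<open>m - 1\<close> because one of the \<open>m\<close> layers is being replaced.\<close>

lemma coverage_moments_le:
  fixes p :: real
  assumes p: "0 \<le> p" "p \<le> 1" and m: "3 \<le> m"
  shows "p ^ 4 * (1 - p\<^sup>2) ^ (m - 1) \<le> 12 / (real m)\<^sup>2"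
    and "p ^ 3 * (1 - p\<^sup>2) ^ (m - 1) \<le> 5 / (real m * sqrt (real m))"
proof -
  define s where "s = p\<^sup>2"
  define b where "b = (1 - s) ^ (m - 1)"
  define M where "M = real (m - 1)"
  have s: "0 \<le> s" "s \<le> 1" using p by (auto simp: s_def abs_square_le_1)
  have b: "0 \<le> b" using s by (simp add: b_def)
  have M: "real m / 2 \<le> M" "real m / 3 \<le> M - 1" using m by (auto simp: M_def)
  have MM: "0 \<le> M * (M - 1) / 2 * s\<^sup>2" "0 \<le> M * s"
    using M m s by (auto intro!: mult_nonneg_nonneg)
  have tot: "b * (1 + M * s + M * (M - 1) / 2 * s\<^sup>2) \<le> 1"
    using power_one_minus_times_quadratic_le[OF s, of "m - 1"] by (simp add: b_def M_def)
  have "b * (M * s) \<le> b * (1 + M * s + M * (M - 1) / 2 * s\<^sup>2)"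
    using MM b by (intro mult_left_mono) auto
  then have "b * (M * s) \<le> 1" using tot by linarith
  moreover have "b * (real m / 2 * s) \<le> b * (M * s)"
    using M b s by (intro mult_left_mono mult_right_mono) auto
  ultimately have 1: "b * (real m * s) \<le> 2" by simp
  have "b * (M * (M - 1) / 2 * s\<^sup>2) \<le> b * (1 + M * s + M * (M - 1) / 2 * s\<^sup>2)"
    using MM b by (intro mult_left_mono) auto
  then have "b * (M * (M - 1) / 2 * s\<^sup>2) \<le> 1" using tot by linarith
  moreover have "b * ((real m / 2) * (real m / 3) / 2 * s\<^sup>2) \<le> b * (M * (M - 1) / 2 * s\<^sup>2)"
    using M b s m by (intro mult_left_mono mult_right_mono divide_right_mono mult_mono) auto
  moreover have "b * ((real m)\<^sup>2 * s\<^sup>2) = 12 * (b * ((real m / 2) * (real m / 3) / 2 * s\<^sup>2))"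
    by (simp add: power2_eq_square)
  ultimately have 2: "b * ((real m)\<^sup>2 * s\<^sup>2) \<le> 12" by linarith
  have p4: "p ^ 4 = s\<^sup>2" by (simp add: s_def power_mult[symmetric])
  show "p ^ 4 * (1 - p\<^sup>2) ^ (m - 1) \<le> 12 / (real m)\<^sup>2"
    using 2 m unfolding p4 s_def[symmetric] b_def[symmetric] by (simp add: field_simps)
  \<comment> \<open>This product is the square of the quantity sought, and 24 is rounded up to
    25.\<close>
  have "(b * (real m * s)) * (b * ((real m)\<^sup>2 * s\<^sup>2)) \<le> 2 * 12"
    using b s by (intro mult_mono 1 2) auto
  moreover have "(p ^ 3 * b * (real m * sqrt (real m)))\<^sup>2 = (b * (real m * s)) * (b * ((real m)\<^sup>2 * s\<^sup>2))"
    by (simp add: s_def power_mult_distrib power2_eq_square power3_eq_cube)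
  ultimately have "(p ^ 3 * b * (real m * sqrt (real m)))\<^sup>2 \<le> 5\<^sup>2" by simp
  then have "p ^ 3 * b * (real m * sqrt (real m)) \<le> 5"
    by (rule power2_le_imp_le) simp
  then show "p ^ 3 * (1 - p\<^sup>2) ^ (m - 1) \<le> 5 / (real m * sqrt (real m))"
    using m unfolding s_def[symmetric] b_def[symmetric] by (simp add: field_simps)
qed

text \<open>Each term is at most \<open>2 / sqrt (real k - 1) - 2 / sqrt (real k)\<close>, and these
  differences telescope.\<close>

lemma sum_inverse_three_halves_le:
  assumes "2 \<le> a"
  shows "(\<Sum>k\<in>{a..<b}. 1 / (real k * sqrt (real k))) \<le> 2 / sqrt (real a - 1)"
proof (cases "a \<le> b")
  case True
  have step: "1 / (real k * sqrt (real k)) \<le> 2 / sqrt (real k - 1) - 2 / sqrt (real (Suc k) - 1)" if "2 \<le> k" for k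
  proof -
    define x y where "x = sqrt (real k - 1)" and "y = sqrt (real k)"
    have xy: "0 < x" "x \<le> y" "y\<^sup>2 - x\<^sup>2 = 1" "real k = y\<^sup>2"
      using that by (auto simp: x_def y_def)
    have "x * (x + y) * y \<le> y * (y + y) * y"
      using xy(1,2) by (intro mult_right_mono mult_mono add_mono) auto
    then have "x * y * (x + y) \<le> 2 * (y\<^sup>2 * y)"
      by (simp add: power2_eq_square algebra_simps)
    then have "2 / (2 * (y\<^sup>2 * y)) \<le> 2 / (x * y * (x + y))"
      using xy(1,2) by (intro divide_left_mono) auto
    then have "1 / (y\<^sup>2 * y) \<le> 2 / (x * y * (x + y))" by simp
    also have "2 / (x * y * (x + y)) = 2 * ((y - x) * (x + y)) / (x * y * (x + y))"
      using xy(3) by (simp add: algebra_simps power2_eq_square)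
    also have "\<dots> = 2 * (y - x) / (x * y)"
      using xy(1,2) by simp
    also have "\<dots> = 2 / x - 2 / y"
      using xy(1,2) by (simp add: field_simps)
    finally show ?thesis by (simp add: x_def y_def)
  qed
  have "(\<Sum>k\<in>{a..<b}. 1 / (real k * sqrt (real k)))
      \<le> (\<Sum>k\<in>{a..<b}. 2 / sqrt (real k - 1) - 2 / sqrt (real (Suc k) - 1))"
    using assms by (intro sum_mono step) auto
  also have "\<dots> = 2 / sqrt (real a - 1) - 2 / sqrt (real b - 1)"
    using sum_Suc_diff'[OF True, of "\<lambda>k. - 2 / sqrt (real k - 1)"] by simp
  also have "\<dots> \<le> 2 / sqrt (real a - 1)" using True assms by simp
  finally show ?thesis .
next
  case False
  then show ?thesis using assms by simp
qed

lemma real_choose_bounds: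
  "real (n choose 3) \<le> real n ^ 3 / 6" "real (n choose 4) \<le> real n ^ 4 / 24"
  "real ((n choose 2) choose 2) \<le> real n ^ 4 / 8"
proof -
  have b: "real (n choose k) \<le> real n ^ k / fact k" for n k
  proof -
    have "real ((n choose k) * fact k) \<le> real (n ^ k)"
      using binomial_fact_pow[of n k] by (simp only: of_nat_le_iff)
    then show ?thesis by (simp add: field_simps)
  qed
  show "real (n choose 3) \<le> real n ^ 3 / 6" "real (n choose 4) \<le> real n ^ 4 / 24"
    using b[of n 3] b[of n 4] by (auto simp: fact_numeral)
  have "real ((n choose 2) choose 2) \<le> real (n choose 2) ^ 2 / 2"
    using b[of "n choose 2" 2] by simp
  also have "\<dots> \<le> (real n ^ 2 / 2) ^ 2 / 2"
    using b[of n 2] by (intro divide_right_mono power_mono) auto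
  finally show "real ((n choose 2) choose 2) \<le> real n ^ 4 / 8"
    by (simp add: power_divide power_mult[symmetric])
qed

section \<open>The cost of one replacement\<close>

lemma mixed_graph_swap_le:
  fixes p :: real and h :: "nat set set \<Rightarrow> real" and n :: nat
  assumes p: "0 \<le> p" "p \<le> 1" and h: "\<And>G. \<bar>h G\<bar> \<le> 1" and m: "3 \<le> m" "m = Suc (k + j)"
  defines "\<delta> \<equiv> \<bar>measure_pmf.expectation (mixed_graph n p k (Suc j)) h
             - measure_pmf.expectation (mixed_graph n p (Suc k) j) h\<bar>"
  shows "\<delta> \<le> 48 * real n ^ 4 / (real m)\<^sup>2 + 10 * real n ^ 3 / (real m * sqrt (real m))"
    and "2 \<le> k \<Longrightarrow> \<delta> \<le> 48 * real n ^ 4 / (real m)\<^sup>2 + 2 * (real n * sqrt (real n)) / (real k * sqrt (real k))"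
proof -
  let ?T = "triangle_gain p n h k j" and ?b = "(1 - p\<^sup>2) ^ (k + j)"
  have s: "0 \<le> p\<^sup>2" "p\<^sup>2 \<le> 1" using square_prob[OF p] by auto
  have b: "0 \<le> ?b" using s by simp
  have kj: "m - 1 = k + j" using m by simp
  have "72 * ?b * real (n choose 4) * p ^ 4 + 8 * ?b * real ((n choose 2) choose 2) * p ^ 4
      = (72 * real (n choose 4) + 8 * real ((n choose 2) choose 2)) * (p ^ 4 * ?b)"
    by (simp add: algebra_simps)
  \<comment> \<open>4 = 72 / 24 + 8 / 8, by the bounds on the two binomial coefficients.\<close>
  also have "\<dots> \<le> (4 * real n ^ 4) * (12 / (real m)\<^sup>2)"
    using real_choose_bounds[of n] coverage_moments_le(1)[OF p m(1), unfolded kj] b p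
    by (intro mult_mono) auto
  finally have err: "72 * ?b * real (n choose 4) * p ^ 4 + 8 * ?b * real ((n choose 2) choose 2) * p ^ 4
      \<le> 48 * real n ^ 4 / (real m)\<^sup>2" by simp
  \<comment> \<open>The two expansions have the same term of order \<open>p\<^sup>2\<close>; only
    the triangle term and the two remainders are left.\<close>
  have "\<delta> \<le> \<bar>p ^ 3 * ?T\<bar> + (72 * ?b * real (n choose 4) * p ^ 4 + 8 * ?b * real ((n choose 2) choose 2) * p ^ 4)"
    unfolding \<delta>_def expectation_mixed_graph_Suc_right[where h = h, OF p h] expectation_mixed_graph_Suc_left[where h = h, OF p h]
    using expectation_gain_clique[where h = h and n = n and k = k and j = j, OF p h]
      expectation_gain_edges[where h = h and n = n and k = k and j = j, OF p h] by linarith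
  with err have \<delta>: "\<delta> \<le> 48 * real n ^ 4 / (real m)\<^sup>2 + p ^ 3 * \<bar>?T\<bar>"
    using p by (simp add: abs_mult)
  have "p ^ 3 * \<bar>?T\<bar> \<le> p ^ 3 * (12 * ?b * real (n choose 3))"
    using triangle_gain_le_coverage[where h = h and n = n and k = k and j = j, OF p h] p by (intro mult_left_mono) auto
  also have "\<dots> = 12 * real (n choose 3) * (p ^ 3 * ?b)" by simp
  also have "\<dots> \<le> (2 * real n ^ 3) * (5 / (real m * sqrt (real m)))"
  proof (rule mult_mono)
    show "12 * real (n choose 3) \<le> 2 * real n ^ 3" using real_choose_bounds(1)[of n] by simp
    show "p ^ 3 * ?b \<le> 5 / (real m * sqrt (real m))"
      by (rule coverage_moments_le(2)[OF p m(1), unfolded kj])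
  qed (use b p in auto)
  finally show "\<delta> \<le> 48 * real n ^ 4 / (real m)\<^sup>2 + 10 * real n ^ 3 / (real m * sqrt (real m))"
    using \<delta> by simp
  assume k: "2 \<le> k"
  have "p ^ 3 * \<bar>?T\<bar> \<le> 2 * (real n * sqrt (real n)) / (real k * sqrt (real k))"
  \<comment> \<open>The smoothing bound divides by \<open>q\<close>, which vanishes for
    \<open>p = 0\<close>; there the factor \<open>p ^ 3\<close> removes the triangle term.\<close>
  proof (cases "p = 0")
    case False
    define q where "q = 1 - (1 - p\<^sup>2) ^ k"
    define w where "w = 3 * ((1 - q) / q)\<^sup>2 + ((1 - q) / q) ^ 3"
    have s': "0 < p\<^sup>2" using False by simp
    have q: "0 < q" "(p\<^sup>2) ^ 3 * w \<le> 13 / real k ^ 3"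
      using odds_ratio_moments_le[OF s' s(2) k] by (auto simp: q_def w_def)
    have q1: "q \<le> 1" using s by (simp add: q_def)
    have w: "0 \<le> w" using q q1 by (auto simp: w_def)
    have "p ^ 3 * \<bar>?T\<bar> \<le> p ^ 3 * sqrt (real (n choose 3) * w)"
      using triangle_gain_le_smoothing[where h = h and n = n and k = k and j = j, OF p h q(1) q_def] p
      by (intro mult_left_mono) (auto simp: w_def)
    \<comment> \<open>Under the root the prefactor becomes \<open>(p\<^sup>2) ^ 3\<close>, which
      cancels the growth of the odds ratio for small \<open>p\<close>.\<close>
    also have "\<dots> = sqrt ((p ^ 3)\<^sup>2 * (real (n choose 3) * w))"
      using p by (simp only: real_sqrt_mult real_sqrt_abs) simp
    also have "(p ^ 3)\<^sup>2 = (p\<^sup>2) ^ 3" by (simp flip: power_mult)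
    also have "sqrt ((p\<^sup>2) ^ 3 * (real (n choose 3) * w)) = sqrt (real (n choose 3) * ((p\<^sup>2) ^ 3 * w))"
      by (simp add: mult_ac)
    also have "\<dots> \<le> sqrt (real n ^ 3 / 6 * (13 / real k ^ 3))"
      using real_choose_bounds(1)[of n] q(2) w by (intro real_sqrt_le_mono mult_mono) auto
    also have "\<dots> \<le> sqrt (4 * (real n ^ 3 / real k ^ 3))"
      using mult_right_mono[of "13 / 6" 4 "real n ^ 3 / real k ^ 3"]
      by (intro real_sqrt_le_mono) simp
    also have "\<dots> = 2 * (real n * sqrt (real n)) / (real k * sqrt (real k))"
      by (simp add: real_sqrt_mult real_sqrt_divide power3_eq_cube)
    finally show ?thesis .
  qed simp
  then show "\<delta> \<le> 48 * real n ^ 4 / (real m)\<^sup>2 + 2 * (real n * sqrt (real n)) / (real k * sqrt (real k))"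
    using \<delta> by simp
qed

section \<open>From test functions to total variation\<close>

text \<open>The sign of the difference of the two mass functions is a test function that attains the
  whole l1 distance, which is twice the total variation.\<close>

lemma tv_dist_graphs_le:
  assumes "set_pmf X \<subseteq> graphs_on n" "set_pmf Y \<subseteq> graphs_on n"
    and le: "\<And>h :: nat set set \<Rightarrow> real. (\<And>G. \<bar>h G\<bar> \<le> 1) \<Longrightarrow>
      \<bar>measure_pmf.expectation X h - measure_pmf.expectation Y h\<bar> \<le> 2 * c"
  shows "tv_dist_graphs n X Y \<le> c"
proof -
  define h where "h G = sgn (pmf X G - pmf Y G)" for G
  have fin: "finite (graphs_on n)" by (simp add: graphs_on_def)
  have E: "measure_pmf.expectation M h = (\<Sum>G\<in>graphs_on n. h G * pmf M G)" if "set_pmf M \<subseteq> graphs_on n" for M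
    using that by (intro integral_measure_pmf_real fin) auto
  have "(\<Sum>G\<in>graphs_on n. \<bar>pmf X G - pmf Y G\<bar>)
      = measure_pmf.expectation X h - measure_pmf.expectation Y h"
    unfolding E[OF assms(1)] E[OF assms(2)] sum_subtractf[symmetric]
    by (intro sum.cong refl) (simp add: h_def abs_sgn algebra_simps)
  also have "\<dots> \<le> 2 * c" using le[of h] by (force simp: h_def abs_sgn_eq)
  finally show ?thesis by (simp add: tv_dist_graphs_def)
qed

lemma tv_dist_graphs_nonneg: "0 \<le> tv_dist_graphs n X Y"
  by (simp add: tv_dist_graphs_def sum_nonneg)

lemma tv_dist_intersection_erdos_renyi_le:
  assumes p: "0 \<le> p" "p \<le> 1" and n: "1 \<le> n" and m: "4 * n \<le> m"
  defines "x \<equiv> (real n)\<^sup>2 / sqrt (real m)"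
  shows "tv_dist_graphs n (random_intersection_graph n m p) (erdos_renyi_graph n (1 - (1 - p\<^sup>2) ^ m))
       \<le> 8 * x + 24 * x\<^sup>2"
proof (rule tv_dist_graphs_le)
  show "set_pmf (random_intersection_graph n m p) \<subseteq> graphs_on n"
    using set_random_intersection_graph by (simp add: graphs_on_def)
  show "set_pmf (erdos_renyi_graph n (1 - (1 - p\<^sup>2) ^ m)) \<subseteq> graphs_on n"
    unfolding graphs_on_def erdos_renyi_graph_def by (rule set_binomial_subset) simp
next
  fix h :: "nat set set \<Rightarrow> real" assume h: "\<And>G. \<bar>h G\<bar> \<le> 1"
  define T where "T k = measure_pmf.expectation (mixed_graph n p k (m - k)) h" for k
  \<comment> \<open>Near \<open>k = m / n\<close> the bounds of order
    \<open>n ^ 3 / m powr (3/2)\<close> and \<open>(n / k) powr (3/2)\<close> on the triangle term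
    coincide, so the switch is made there.\<close>
  define a where "a = m div n"
  define A where "A = 48 * real n ^ 4 / (real m)\<^sup>2"
  define B where "B = 10 * real n ^ 3 / (real m * sqrt (real m))"
  define C where "C k = 2 * (real n * sqrt (real n)) / (real k * sqrt (real k))" for k
  have m4: "4 \<le> m" "0 < real m" using n m by auto
  \<comment> \<open>The hypothesis \<open>4 * n \<le> m\<close> keeps the switch away from 0, so
    that \<open>2 \<le> k\<close> holds wherever the smoothing bound is used.\<close>
  have "4 * n div n \<le> a" unfolding a_def using m by (rule div_le_mono)
  then have a: "4 \<le> a" "a \<le> m" using n by (auto simp: a_def)
  have step: "\<bar>T k - T (Suc k)\<bar> \<le> A + (if k < a then B else C k)" if "k < m" for k
  proof -
    have "m = Suc (k + (m - Suc k))" "m - k = Suc (m - Suc k)" using that by auto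
    then show ?thesis
      using mixed_graph_swap_le[OF p h, of m k "m - Suc k" n] m4 a by (auto simp: T_def A_def B_def C_def)
  qed
  have "\<bar>T 0 - T m\<bar> = \<bar>\<Sum>k<m. T k - T (Suc k)\<bar>"
    by (simp add: sum_lessThan_telescope')
  also have "\<dots> \<le> (\<Sum>k<m. A + (if k < a then B else C k))"
    using step by (intro order_trans[OF sum_abs sum_mono]) auto
  also have "\<dots> = real m * A + (\<Sum>k<m. if k < a then B else C k)"
    by (simp add: sum.distrib)
  also have "(\<Sum>k<m. if k < a then B else C k) = real a * B + (\<Sum>k\<in>{a..<m}. C k)"
  proof -
    have "{..<m} = {..<a} \<union> {a..<m}" using a by auto
    then have "(\<Sum>k<m. if k < a then B else C k)
        = (\<Sum>k<a. if k < a then B else C k) + (\<Sum>k\<in>{a..<m}. if k < a then B else C k)"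
      by (simp add: sum.union_disjoint ivl_disj_int)
    also have "\<dots> = real a * B + (\<Sum>k\<in>{a..<m}. C k)" by simp
    finally show ?thesis .
  qed
  finally have total: "\<bar>T 0 - T m\<bar> \<le> real m * A + (real a * B + (\<Sum>k\<in>{a..<m}. C k))" .
  have "real m * A = 48 * x\<^sup>2"
    using m4 by (simp add: A_def x_def field_simps power2_eq_square eval_nat_numeral)
  moreover have "real a * B \<le> 10 * x"
  proof -
    have "real a \<le> real m / real n"
    proof -
      have "a * n \<le> m" unfolding a_def by (rule div_times_less_eq_dividend)
      then have "real a * real n \<le> real m" by (metis of_nat_le_iff of_nat_mult)
      then show ?thesis using n by (simp add: field_simps)
    qed
    then have "real a * B \<le> real m / real n * B"
      by (intro mult_right_mono) (auto simp: B_def)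
    also have "\<dots> = 10 * x"
      using m4 n by (simp add: B_def x_def power2_eq_square power3_eq_cube)
    finally show ?thesis .
  qed
  moreover have "(\<Sum>k\<in>{a..<m}. C k) \<le> 6 * x"
  proof -
    have "m < n + n * a"
      unfolding a_def using n by (intro dividend_less_times_div) simp
    then have "real m < real n + real n * real a"
      by (metis of_nat_add of_nat_less_iff of_nat_mult)
    then have "real m / real n < real a + 1"
      using n by (simp add: field_simps)
    moreover have "4 \<le> real m / real n"
    proof -
      have "4 * real n \<le> real m" using m by linarith
      then show ?thesis using n by (simp add: pos_le_divide_eq)
    qed
    \<comment> \<open>Rounding costs little: as \<open>real m / real n\<close> is at least 4, half
      of it is at most \<open>real m / real n - 2\<close>, which is below
      \<open>real a - 1\<close>.\<close>
    ultimately have a': "real m / (2 * real n) \<le> real a - 1" by simp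
    have "(\<Sum>k\<in>{a..<m}. C k) = 2 * (real n * sqrt (real n)) * (\<Sum>k\<in>{a..<m}. 1 / (real k * sqrt (real k)))"
      by (simp add: C_def sum_distrib_left)
    also have "\<dots> \<le> 2 * (real n * sqrt (real n)) * (2 / sqrt (real a - 1))"
      using a by (intro mult_left_mono sum_inverse_three_halves_le) auto
    also have "\<dots> \<le> 2 * (real n * sqrt (real n)) * (2 / sqrt (real m / (2 * real n)))"
      using a a' m4 n by (intro mult_left_mono divide_left_mono real_sqrt_le_mono mult_pos_pos) auto
    also have "\<dots> = 4 * sqrt 2 * x"
      by (simp add: x_def real_sqrt_divide real_sqrt_mult power2_eq_square)
    \<comment> \<open>\<open>sqrt 2\<close> is at most 3/2.\<close>
    also have "\<dots> \<le> 4 * (3 / 2) * x"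
      by (intro mult_right_mono mult_left_mono real_le_lsqrt) (auto simp: x_def power2_eq_square)
    finally show ?thesis by simp
  qed
  ultimately have "\<bar>T 0 - T m\<bar> \<le> 48 * x\<^sup>2 + (10 * x + 6 * x)"
    using total by (elim order_trans[OF _ add_mono[OF eq_refl add_mono]])
  then have "\<bar>T 0 - T m\<bar> \<le> 2 * (8 * x + 24 * x\<^sup>2)"
    by (simp add: algebra_simps)
  then show "\<bar>measure_pmf.expectation (random_intersection_graph n m p) h
     - measure_pmf.expectation (erdos_renyi_graph n (1 - (1 - p\<^sup>2) ^ m)) h\<bar> \<le> 2 * (8 * x + 24 * x\<^sup>2)"
    by (simp add: T_def mixed_graph_0_left mixed_graph_0_right)
qed

text \<open>The growth hypothesis says that the square root of
  \<open>real (m n) / real n ^ 4\<close> diverges, and its inverse is the quantity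
  \<open>x n\<close> in the explicit bound \<open>8 * x n + 24 * (x n)\<^sup>2\<close>; a sandwich
  argument concludes.\<close>

theorem theorem1p2:
  fixes m :: "nat \<Rightarrow> nat" and p :: "nat \<Rightarrow> real"
  assumes "filterlim (\<lambda>n. real (m n) / real n ^ 4) at_top sequentially"
    and "\<And>n. 0 \<le> p n" and "\<And>n. p n \<le> 1"
  shows "(\<lambda>n. tv_dist_graphs n
            (random_intersection_graph n (m n) (p n))
            (erdos_renyi_graph n (1 - (1 - (p n)\<^sup>2) ^ m n))) \<in> o(\<lambda>_. 1)"
proof -
  define x where "x n = (real n)\<^sup>2 / sqrt (real (m n))" for n
  have "filterlim (\<lambda>n. sqrt (real (m n) / real n ^ 4)) at_top sequentially"
    by (rule filterlim_compose[OF sqrt_at_top assms(1)])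
  then have "(\<lambda>n. inverse (sqrt (real (m n) / real n ^ 4))) \<longlonglongrightarrow> 0"
    by (rule tendsto_inverse_0_at_top)
  moreover have "inverse (sqrt (real (m n) / real n ^ 4)) = x n" for n
  proof -
    have "sqrt (real n ^ 4) = (real n)\<^sup>2"
      by (rule real_sqrt_unique) (simp_all add: power_mult[symmetric])
    then show ?thesis by (simp add: x_def real_sqrt_divide)
  qed
  ultimately have x: "x \<longlonglongrightarrow> 0" by simp
  have "(\<lambda>n. 8 * x n + 24 * (x n)\<^sup>2) \<longlonglongrightarrow> 8 * 0 + 24 * 0\<^sup>2"
    by (intro tendsto_intros x)
  moreover have "\<forall>\<^sub>F n in sequentially. tv_dist_graphs n (random_intersection_graph n (m n) (p n))
      (erdos_renyi_graph n (1 - (1 - (p n)\<^sup>2) ^ m n)) \<le> 8 * x n + 24 * (x n)\<^sup>2"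
    \<comment> \<open>The threshold 4 gives \<open>4 * n \<le> m n\<close> for all large
      \<open>n\<close>, as the explicit bound demands.\<close>
    using filterlim_at_top[THEN iffD1, OF assms(1), rule_format, of 4] eventually_ge_at_top[of 1]
  proof eventually_elim
    case (elim n)
    then have "4 * real n ^ 4 \<le> real (m n)" by (simp add: pos_le_divide_eq)
    moreover have "real n \<le> real n ^ 4" using elim by (intro self_le_power) auto
    ultimately have "4 * n \<le> m n" by linarith
    with elim show ?case
      unfolding x_def by (intro tv_dist_intersection_erdos_renyi_le assms(2,3))
  qed
  moreover have "\<forall>\<^sub>F n in sequentially. 0 \<le> tv_dist_graphs n
      (random_intersection_graph n (m n) (p n)) (erdos_renyi_graph n (1 - (1 - (p n)\<^sup>2) ^ m n))"
    by (simp add: tv_dist_graphs_nonneg)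
  ultimately have "(\<lambda>n. tv_dist_graphs n (random_intersection_graph n (m n) (p n))
      (erdos_renyi_graph n (1 - (1 - (p n)\<^sup>2) ^ m n))) \<longlonglongrightarrow> 0"
    using tendsto_sandwich[OF _ _ tendsto_const] by fastforce
  then show ?thesis
    by (intro smalloI_tendsto) simp_all
qed

end
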